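(* Let $s \ge 3$ be an integer, let $n$ be an integer with $n \ge 4s+1$ and $n \equiv 3 \pmod{2s-1}$, and let $A=\{1,2,\dots,n\}$. Then the list of sequences $T_s(n) = (\sigma_1,\sigma_2,\dots,\sigma_n)$ is strongly complete over $A$.
   Context: Sequence notation. All sequences are finite. A sequence $\rho$ is a subsequence of $\sigma$, written $\rho<\sigma$, if $\rho$ is obtained from $\sigma$ by deleting zero or more elements, keeping the order of the others. $l_\sigma$ is the length of $\sigma$; $\sigma[i]$ is its $i$-th element and $\sigma[-j]$ its $j$-th element from the end ($\sigma[-1]$ is the last element). $\sigma[i,j]$ is the block of consecutive elements from position $i$ to position $j$ inclusive, where negative positions count from the end (position $-j$ means position $l_\sigma-j+1$). Juxtaposition or a dot $\cdot$ denotes concatenation of sequences and/or single letters. Completeness. $[A]_k$ is the set of sequences of length $k$ over $A$ with pairwise distinct elements. For $k\le |A|$, a sequence $\sigma$ over $A$ is $k$-complete if $\rho<\sigma$ for every $\rho\in[A]_k$. A list $\sigma_1,\dots,\sigma_n$ of sequences over $A$ ($n\le|A|$) is forward complete if $\sigma_1\sigma_2\cdots\sigma_k$ is $k$-complete for all $1\le k\le n$; backward complete if $\sigma_{n-k+1}\sigma_{n-k+2}\cdots\sigma_n$ is $k$-complete for all $1\le k\le n$; strongly complete if it is both forward and backward complete. The list $T_s(n)$. Let $\phi_s=\langle n-s+2,\dots,n-1,n\rangle$ and $\phi_{-s}=\langle n,n-1,\dots,n-s+2\rangle$ (these $s-1$ letters are called the skip letters). Define $\sigma_1,\dots,\sigma_n$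 over $A=\{1,\dots,n\}$ recursively: (1) $\sigma_1=\langle 1,2,\dots,n\rangle$, $\sigma_2=\langle 1,2,\dots,n-1\rangle$, and $\sigma_k=\sigma_{k-2}[-1]\cdot\sigma_{k-1}[1,-2]$ for $3\le k\le s+1$. For $s+1<k<n-s$: (2) if $k\equiv s+2 \pmod{2s-1}$: for $k=s+2$, $\sigma_k=\sigma_{k-2}[-1]\cdot\sigma_{k-1}[s,-s-1]\cdot\phi_s\cdot\sigma_{k-1}[-s,-2]$; for $k>s+2$, $\sigma_k=\sigma_{k-2}[-1]\cdot\sigma_{k-1}[1,s-1]\cdot\sigma_{k-1}[2s-1,-s-1]\cdot\phi_s\cdot\sigma_{k-1}[-s,-2]$. (3) if $k$ is congruent modulo $2s-1$ to one of $s+3,s+4,\dots,2s$ (where $2s\equiv 1$): $\sigma_k=\sigma_{k-2}[-1]\cdot\sigma_{k-1}[1,-2]$. (4) if $k\equiv 2\pmod{2s-1}$: $\sigma_k=\sigma_{k-2}[-1]\cdot\sigma_{k-1}[1,-s-1]$ (of length $n-s$). (5) if $k\equiv 3\pmod{2s-1}$: $\sigma_k=\sigma_{k-2}[-1]\cdot\phi_{-s}\cdot\sigma_{k-1}[1,-2]$. (6) if $k$ is congruent modulo $2s-1$ to one of $4,5,\dots,s+1$: $\sigma_k=\sigma_{k-2}[-1]\cdot\sigma_{k-1}[1,-2]$. (7) Finally, $\sigma_{n-s}=\sigma_{n-s-2}[-1]\cdot\sigma_{n-s-1}[1,s-1]\cdot\sigma_{n-s-1}[2s-1,-2]\cdot\phi_{-s}$;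 $\sigma_{n-s+i}=\sigma_{n-s+i-2}[-1]\cdot\sigma_{n-s+i-1}[1,-2]$ for $1\le i<s$; and $\sigma_n=\sigma_{n-2}[-1]\cdot\sigma_{n-1}$. $T_s(n)$ is the list $(\sigma_1,\dots,\sigma_n)$. *)

theory Defs
  imports "HOL-Library.Sublist" "HOL-Number_Theory.Cong"
begin

section \<open>Completeness\<close>

definition arrangements :: "'a set \<Rightarrow> nat \<Rightarrow> 'a list set" where
  "arrangements A k = {\<rho>. set \<rho> \<subseteq> A \<and> length \<rho> = k \<and> distinct \<rho>}"

definition k_complete :: "'a set \<Rightarrow> nat \<Rightarrow> 'a list \<Rightarrow> bool" where
  "k_complete A k \<sigma> \<longleftrightarrow>
     k \<le> card A \<and> set \<sigma> \<subseteq> A \<and> (\<forall>\<rho>\<in>arrangements A k. subseq \<rho> \<sigma>)"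

definition list_over :: "'a set \<Rightarrow> 'a list list \<Rightarrow> bool" where
  "list_over A \<sigma>s \<longleftrightarrow> length \<sigma>s \<le> card A \<and> (\<forall>\<sigma>\<in>set \<sigma>s. set \<sigma> \<subseteq> A)"

definition forward_complete :: "'a set \<Rightarrow> 'a list list \<Rightarrow> bool" where
  "forward_complete A \<sigma>s \<longleftrightarrow> list_over A \<sigma>s \<and>
     (\<forall>k\<in>{1..length \<sigma>s}. k_complete A k (concat (take k \<sigma>s)))"

definition backward_complete :: "'a set \<Rightarrow> 'a list list \<Rightarrow> bool" where
  "backward_complete A \<sigma>s \<longleftrightarrow> list_over A \<sigma>s \<and>
     (\<forall>k\<in>{1..length \<sigma>s}. k_complete A k (concat (drop (length \<sigma>s - k) \<sigma>s)))"

definition strongly_complete :: "'a set \<Rightarrow> 'a list list \<Rightarrow> bool" where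
  "strongly_complete A \<sigma>s \<longleftrightarrow> forward_complete A \<sigma>s \<and> backward_complete A \<sigma>s"


section \<open>Positions and blocks\<close>

text \<open>Positions count from 1; a negative position \<open>- j\<close> means the \<open>j\<close>-th from the end.\<close>

definition position :: "'a list \<Rightarrow> int \<Rightarrow> nat" where
  "position \<sigma> i = nat (if i < 0 then int (length \<sigma>) + i + 1 else i)"

definition element :: "'a list \<Rightarrow> int \<Rightarrow> 'a" where
  "element \<sigma> i = \<sigma> ! (position \<sigma> i - 1)"

definition block :: "'a list \<Rightarrow> int \<Rightarrow> int \<Rightarrow> 'a list" where
  "block \<sigma> i j = drop (position \<sigma> i - 1) (take (position \<sigma> j) \<sigma>)"


section \<open>The list \<open>T\<^sub>s(n)\<close>\<close>

definition skip_up :: "nat \<Rightarrow> nat \<Rightarrow> nat list" where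
  "skip_up s n = [n - s + 2..<n + 1]"

definition skip_down :: "nat \<Rightarrow> nat \<Rightarrow> nat list" where
  "skip_down s n = rev (skip_up s n)"

text \<open>
  Every term of index \<open>k \<ge> 3\<close> is \<open>\<sigma>\<^sub>k\<^sub>-\<^sub>2[-1]\<close> followed by the list \<open>T_tail s n k \<sigma>\<^sub>k\<^sub>-\<^sub>1\<close>.
  The last branch for \<open>s + 1 < k < n - s\<close> covers the residues \<open>4, \<dots>, s + 1\<close>, which are
  the ones left over modulo \<open>2s - 1\<close>.
\<close>

definition T_tail :: "nat \<Rightarrow> nat \<Rightarrow> nat \<Rightarrow> nat list \<Rightarrow> nat list" where
  "T_tail s n k \<sigma> =
    (if k \<le> s + 1 then block \<sigma> 1 (- 2)
     else if k < n - s then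
       (if k = s + 2 then
          block \<sigma> (int s) (- int s - 1) @ skip_up s n @ block \<sigma> (- int s) (- 2)
        else if [k = s + 2] (mod (2 * s - 1)) then
          block \<sigma> 1 (int s - 1) @ block \<sigma> (2 * int s - 1) (- int s - 1)
            @ skip_up s n @ block \<sigma> (- int s) (- 2)
        else if (\<exists>r\<in>{s + 3..2 * s}. [k = r] (mod (2 * s - 1))) then block \<sigma> 1 (- 2)
        else if [k = 2] (mod (2 * s - 1)) then block \<sigma> 1 (- int s - 1)
        else if [k = 3] (mod (2 * s - 1)) then skip_down s n @ block \<sigma> 1 (- 2)
        else block \<sigma> 1 (- 2))
     else if k = n - s then
       block \<sigma> 1 (int s - 1) @ block \<sigma> (2 * int s - 1) (- 2) @ skip_down s n
     else if k < n then block \<sigma> 1 (- 2)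
     else \<sigma>)"

text \<open>The value at index \<open>0\<close> is a dummy.\<close>

fun T_seq :: "nat \<Rightarrow> nat \<Rightarrow> nat \<Rightarrow> nat list" where
  "T_seq s n 0 = []"
| "T_seq s n (Suc 0) = [1..<n + 1]"
| "T_seq s n (Suc (Suc 0)) = [1..<n]"
| "T_seq s n (Suc (Suc (Suc m))) =
     element (T_seq s n (Suc m)) (- 1) # T_tail s n (m + 3) (T_seq s n (Suc (Suc m)))"

definition T_list :: "nat \<Rightarrow> nat \<Rightarrow> nat list list" where
  "T_list s n = map (T_seq s n) [1..<n + 1]"

end

(*
  Deleting the s - 1 skip letters m + 1, ..., n (m = n - s + 1) from the concatenation of the
  terms leaves the periodic word 1, ..., m, 1, ..., m, ..., cut into pieces of m letters
  (up to term s and from term n - s + 1 on) or m - 1 letters (in between); the skip letters are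
  inserted as blocks at explicit places. Term k lacks, besides possibly the skip letters, only the last letter of term k - 1.

  Forward completeness: let \<rho> be an arrangement of length k < n - s, embedded greedily, and let p be
  the number of skip letters among its first k - 1 letters. Two consecutive distinct letters outside
  the skip letters are at most m - 1 steps apart in the periodic word, and only a letter
  following a skip letter may need m steps. So the embedding never falls behind: in term k at least
  min k s - 1 - p of the letters 1, ..., m are left over at the end. The terms without skip letters
  cost nothing: if the next letter is a skip letter, at most s - 2 of them have been used, so the
  embedding ends before the skip block at the end of the previous term.

  Backward completeness: reversing the list and every term in it amounts to renaming the letters by
  the involution flip, so it follows from forward completeness.
*)

theory Submission
  imports Defs
begin

section \<open>Lists\<close>

lemma element_minus1: "\<sigma> \<noteq> [] \<Longrightarrow> element \<sigma> (- 1) = last \<sigma>"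
  by (simp add: element_def position_def last_conv_nth nat_diff_distrib)

lemma block_butlast: "block \<sigma> 1 (- 2) = butlast \<sigma>"
  by (simp add: block_def position_def butlast_conv_take nat_diff_distrib')

lemma block_take: "block \<sigma> 1 (int k) = take k \<sigma>"
  by (simp add: block_def position_def)

lemma block_drop_end:
  assumes "i \<ge> 1"
  shows "block \<sigma> (int i) (- int k - 1) = drop (i - 1) (take (length \<sigma> - k) \<sigma>)"
proof -
  have "nat (int (length \<sigma>) - int k) = length \<sigma> - k" by linarith
  then show ?thesis using assms by (simp add: block_def position_def algebra_simps)
qed

lemma block_suffix:
  assumes "1 \<le> k" "k \<le> length \<sigma>"
  shows "block \<sigma> (- int k) (- 2) = drop (length \<sigma> - k) (butlast \<sigma>)"
proof -
  have "nat (int (length \<sigma>) - int k + 1) - 1 = length \<sigma> - k"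
       "nat (int (length \<sigma>) - 1) = length \<sigma> - 1" using assms by linarith+
  then show ?thesis using assms
    by (simp add: block_def position_def algebra_simps butlast_conv_take)
qed

lemma butlast_rev_upt: "a < b \<Longrightarrow> butlast (rev [a..<b]) = rev [Suc a..<b]"
  by (simp add: upt_conv_Cons)

lemma rev_upt_Cons: "a \<le> b \<Longrightarrow> rev [a..<Suc b] = b # rev [a..<b]"
  by simp

lemma butlast_append_upt: "a < b \<Longrightarrow> butlast (xs @ [a..<b]) = xs @ [a..<b - 1]"
  by (cases b) (auto simp: butlast_append)

lemma upt_Cons_diff:
  assumes "n + 3 - k < b" "k \<le> n + 3"
  shows "[n + 3 - k..<b] = (n + 3 - k) # [n + 4 - k..<b]"
proof -
  have "Suc (n + 3 - k) = n + 4 - k" using assms by linarith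
  then show ?thesis using upt_conv_Cons[OF assms(1)] by simp
qed

lemma take_append_length: "length xs = k \<Longrightarrow> take k (xs @ ys) = xs"
  by simp

lemma drop_append_length: "length xs = k \<Longrightarrow> drop k (xs @ ys) = ys"
  by simp

lemma take_diff_append: "length ys = k \<Longrightarrow> take (length (xs @ ys) - k) (xs @ ys) = xs"
  by simp

lemma upt_add_append: "a \<le> b \<Longrightarrow> b \<le> c \<Longrightarrow> [a..<b] @ [b..<c] = [a..<c]"
  by (metis le_iff_add upt_add_eq_append)

text \<open>The last letter \<open>y\<close> can only be matched outside \<open>ws\<close>, and
  everything before it is matched further left.\<close>

lemma subseq_strip_suffix:
  assumes "subseq (xs @ [y]) (vs @ ws)" "y \<notin> set ws"
  shows "subseq (xs @ [y]) vs"
proof -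
  obtain as bs where e: "xs @ [y] = as @ bs" "subseq as vs" "subseq bs ws"
    using assms(1) unfolding subseq_append_iff by blast
  show ?thesis
  proof (cases bs rule: rev_cases)
    case Nil
    then show ?thesis using e by simp
  next
    case (snoc bs' b)
    then have "y \<in> set bs" using e by simp
    with e(3) obtain z where "z \<in> set ws" "y = z" by (rule list_emb_set)
    then show ?thesis using assms(2) by simp
  qed
qed

text \<open>The step of the greedy embedding: an embedding that ends in \<open>y\<close> leaves
  \<open>ws\<close> untouched, so the next letter may be taken from \<open>ws\<close> before going
  on to \<open>zs\<close>.\<close>

lemma subseq_extend:
  assumes "subseq (xs @ [y]) (vs @ ws)" "y \<notin> set ws" "x \<in> set ws \<union> set zs"
  shows "subseq (xs @ [y, x]) (vs @ ws @ zs)"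
proof -
  have "subseq [x] (ws @ zs)" using assms(3) by (simp add: subseq_singleton_left)
  with subseq_strip_suffix[OF assms(1,2)] have "subseq ((xs @ [y]) @ [x]) (vs @ (ws @ zs))"
    by (rule list_emb_append_mono)
  then show ?thesis by simp
qed

lemma takeWhile_neq_upt: "a \<le> c \<Longrightarrow> c \<le> b \<Longrightarrow> takeWhile (\<lambda>z. z \<noteq> c) [a..<b] = [a..<c]"
  and dropWhile_neq_upt: "a \<le> c \<Longrightarrow> c \<le> b \<Longrightarrow> dropWhile (\<lambda>z. z \<noteq> c) [a..<b] = [c..<b]"
proof -
  assume "a \<le> c" "c \<le> b"
  then have e: "[a..<b] = [a..<c] @ [c..<b]" using upt_add_append[of a c b] by simp
  have t: "takeWhile (\<lambda>z. z \<noteq> c) [c..<b] = [] \<and> dropWhile (\<lambda>z. z \<noteq> c) [c..<b] = [c..<b]"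
    by (cases "c < b") (simp_all add: upt_conv_Cons)
  show "takeWhile (\<lambda>z. z \<noteq> c) [a..<b] = [a..<c]" unfolding e by (subst takeWhile_append2) (auto simp: t)
  show "dropWhile (\<lambda>z. z \<noteq> c) [a..<b] = [c..<b]" unfolding e by (subst dropWhile_append2) (auto simp: t)
qed

lemma subseq_rev: "subseq xs ys \<Longrightarrow> subseq (rev xs) (rev ys)"
proof (induction rule: list_emb.induct)
  case (list_emb_Cons xs ys y)
  then show ?case by (simp add: subseq_rev_drop_many)
next
  case (list_emb_Cons2 x y xs ys)
  then show ?case by (simp add: list_emb_append_mono)
qed simp

lemma map_diff_upt: "b \<le> k + 1 \<Longrightarrow> map (\<lambda>x. k - x) [a..<b] = rev [k + 1 - b..<k + 1 - a]" for k :: nat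
proof (induction b)
  case (Suc b)
  show ?case
  proof (cases "a \<le> b")
    case True
    then have "k - b < k + 1 - a" "Suc (k - b) = k + 1 - b" using Suc.prems by linarith+
    then have "[k - b..<k + 1 - a] = (k - b) # [k + 1 - b..<k + 1 - a]"
      by (simp only: upt_conv_Cons)
    then show ?thesis using Suc True by simp
  qed (use Suc in simp)
qed simp

section \<open>Closed form of the terms\<close>

text \<open>\<open>m\<close> is the number of letters that are not skip letters, and \<open>M + 1\<close> is the number of periods of
  length \<open>q = 2s - 1\<close> between the terms \<open>s + 2\<close> and \<open>n - s - 1\<close>.\<close>

locale skip_list =
  fixes s n m q M :: nat
  assumes s3: "3 \<le> s"
    and q_eq: "q + 1 = 2 * s"
    and n_eq: "n = 4 * s + 1 + M * q"
    and m_eq: "n + 1 = m + s"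
begin

text \<open>The shapes of a term of index \<open>t\<close>. In \<open>up\<close> and \<open>down\<close> the block of skip letters directly follows
  the letter \<open>c\<close>, which is constant throughout a run of \<open>s - 1\<close> consecutive terms; \<open>late i\<close> is the
  term \<open>n - s + i\<close>.\<close>

definition early where "early t = [n + 3 - t..<n + 1] @ [1..<n + 2 - t]"

definition up where
  "up c t = [n + 3 - t..<m + 1] @ [1..<c + 1] @ [m + 1..<n + 1] @ [c + 1..<n + 2 - t]"

definition bare where "bare t = [n + 3 - t..<m + 1] @ [1..<n + 2 - t]"

definition down where
  "down c t = [n + 3 - t..<c + 1] @ rev [m + 1..<n + 1] @ [c + 1..<m + 1] @ [1..<n + 2 - t]"

definition late where
  "late i = rev [m + 1..<m + i] @ [s + 2..<m + 1] @ [1..<s + 2] @ rev [m + 1 + i..<n + 1]"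

text \<open>Here \<open>w\<close> is the position of \<open>t\<close> within its period. So
  \<open>t - w\<close> is the first term of the current \<open>up\<close> run and
  \<open>t - (w - s)\<close> the first term of the current \<open>down\<close> run, which makes the
  first argument of \<open>up\<close> and \<open>down\<close> constant along a run.\<close>

definition form where
  "form t = (let w = (t - (s + 2)) mod q in
     if t \<le> s + 1 then early t
     else if t < n - s then
       if w < s - 1 then up (m + 1 - (t - w)) t
       else if w = s - 1 then bare t
       else down (n + 3 - (t - (w - s))) t
     else if t = n - s then [s + 3..<m + 1] @ [1..<s + 2] @ rev [m + 1..<n + 1]
     else late (t - (n - s)))"

lemma q_ge: "q \<ge> 5" using q_eq s3 by simp

lemma form_early: "t \<le> s + 1 \<Longrightarrow> form t = early t"
  by (simp add: form_def)

lemma uq_le: "u \<le> M \<Longrightarrow> u * q \<le> M * q" by simp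

lemma form_up:
  assumes "u \<le> M" "v + 2 \<le> s" "t = s + 2 + u * q + v"
  shows "form t = up (m - (s + 1 + u * q)) t"
proof -
  have "v < q" using assms q_eq by simp
  then have w: "(t - (s + 2)) mod q = v" using assms(3) by simp
  have "t < n - s" using assms q_eq n_eq uq_le[OF assms(1)] s3 by linarith
  moreover have "m + 1 - (t - v) = m - (s + 1 + u * q)" using assms(3) by simp
  moreover have "v < s - 1" "\<not> t \<le> s + 1" using assms by linarith+
  ultimately show ?thesis unfolding form_def w Let_def by simp
qed

lemma form_bare:
  assumes "u \<le> M" "t = s + 2 + u * q + (s - 1)"
  shows "form t = bare t"
proof -
  have "s - 1 < q" using s3 q_eq by simp
  then have w: "(t - (s + 2)) mod q = s - 1" using assms(2) by simp
  have "t < n - s" using assms q_eq n_eq uq_le[OF assms(1)] s3 by linarith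
  moreover have "\<not> t \<le> s + 1" using assms by linarith
  ultimately show ?thesis unfolding form_def w Let_def by simp
qed

lemma form_down:
  assumes "u \<le> M" "v + 2 \<le> s" "t = 2 * s + 2 + u * q + v"
  shows "form t = down (n + 1 - (2 * s + u * q)) t"
proof -
  have "s + v < q" using assms q_eq by simp
  moreover have "t - (s + 2) = (s + v) + u * q" using assms(3) by simp
  ultimately have w: "(t - (s + 2)) mod q = s + v" by simp
  have "t < n - s" using assms q_eq n_eq uq_le[OF assms(1)] s3 by linarith
  moreover have "n + 3 - (t - (s + v - s)) = n + 1 - (2 * s + u * q)" using assms(3) by simp
  moreover have "\<not> t \<le> s + 1" "\<not> s + v < s - 1" "s + v \<noteq> s - 1" using assms s3 by linarith+
  ultimately show ?thesis unfolding form_def w Let_def by simp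
qed

lemma form_end: "form (n - s) = [s + 3..<m + 1] @ [1..<s + 2] @ rev [m + 1..<n + 1]"
proof -
  have "\<not> n - s \<le> s + 1" using n_eq s3 by linarith
  then show ?thesis unfolding form_def Let_def by simp
qed

lemma form_late: "1 \<le> i \<Longrightarrow> form (n - s + i) = late i"
proof -
  assume "1 \<le> i"
  then have "\<not> n - s + i \<le> s + 1" "\<not> n - s + i < n - s" "n - s + i \<noteq> n - s"
    using n_eq s3 by linarith+
  then show ?thesis unfolding form_def Let_def by simp
qed

text \<open>A period of \<open>q\<close> terms consists of \<open>s - 1\<close> terms
  \<open>up\<close>, one term \<open>bare\<close> and \<open>s - 1\<close> terms
  \<open>down\<close>. Term \<open>n - s - 1\<close> is the last one of period \<open>M\<close>, so
  the range is exhausted by full periods.\<close>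

lemma mid_cases:
  assumes "s + 1 < t" "t < n - s"
  obtains (up) u v where "u \<le> M" "v + 2 \<le> s" "t = s + 2 + u * q + v"
    | (bare) u where "u \<le> M" "t = s + 2 + u * q + (s - 1)"
    | (down) u v where "u \<le> M" "v + 2 \<le> s" "t = 2 * s + 2 + u * q + v"
proof -
  define u where "u = (t - (s + 2)) div q"
  define w where "w = (t - (s + 2)) mod q"
  have t: "t = s + 2 + u * q + w" using assms(1) unfolding u_def w_def by simp
  have w: "w < q" unfolding w_def using q_ge by simp
  have "u * q < (M + 1) * q" using t assms n_eq q_eq s3 by (simp add: algebra_simps)
  then have u: "u \<le> M" unfolding mult_less_cancel2 by simp
  consider "w + 2 \<le> s" | "w = s - 1" | "w \<ge> s" by linarith
  then show thesis
  proof cases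
    case 1 then show ?thesis using up u t by blast
  next
    case 2 then show ?thesis using bare u t by blast
  next
    case 3 then show ?thesis using down[of u "w - s"] u t w q_eq by simp
  qed
qed

text \<open>In every shape the final run is nonempty and stops at \<open>n + 1 - t\<close>. Hence
  the letter that the recursion puts in front of term \<open>k\<close> is
  \<open>n + 3 - k\<close>.\<close>

lemma last_form:
  assumes "1 \<le> t" "t < n - s"
  shows "form t \<noteq> [] \<and> last (form t) = n + 1 - t"
proof (cases "t \<le> s + 1")
  case True
  then show ?thesis using assms by (auto simp: form_early early_def)
next
  case False
  then have "s + 1 < t" by simp
  from this assms(2) show ?thesis
  proof (cases rule: mid_cases)
    case (up u v)
    have "u * q \<le> M * q" using up by simp
    then have "m - (s + 1 + u * q) + 1 < n + 2 - t"
      using up n_eq m_eq s3 q_eq by linarith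
    then show ?thesis using form_up[OF up] assms by (simp add: up_def last_append)
  next
    case (bare u)
    have "1 < n + 2 - t" using assms by linarith
    then show ?thesis using form_bare[OF bare] by (simp add: bare_def last_append)
  next
    case (down u v)
    have "1 < n + 2 - t" using assms by linarith
    then show ?thesis using form_down[OF down] by (simp add: down_def last_append)
  qed
qed

section \<open>Branches of the recursion, by the position of the index in its period\<close>

lemma cong_index:
  assumes "u \<le> M" "w < q" "r < q"
  shows "[s + 2 + u * q + w = s + 2 + r] (mod (2 * s - 1)) \<longleftrightarrow> w = r"
proof -
  have "2 * s - 1 = q" using q_eq by simp
  moreover have "[s + 2 + u * q + w = s + 2 + r] (mod q) \<longleftrightarrow> [u * q + w = r] (mod q)"
    using cong_add_lcancel_nat[of "s + 2" "u * q + w" r q] by (simp add: add.assoc)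
  ultimately show ?thesis using assms by (simp add: cong_def)
qed

text \<open>All congruences turn into equations for \<open>w\<close>. Residues 2 and 3 are read as
  \<open>2 + q = s + 2 + (s - 1)\<close> and \<open>3 + q = s + 2 + s\<close>. The residues
  \<open>s + 3\<close> to \<open>2 * s\<close> share their rule with the residues left over, so they
  are merged into the last branch.\<close>

lemma tail_index:
  assumes "u \<le> M" "w < q" "k = s + 2 + u * q + w" "k < n - s"
  shows "T_tail s n k \<sigma> =
    (if k = s + 2 then block \<sigma> (int s) (- int s - 1) @ skip_up s n @ block \<sigma> (- int s) (- 2)
     else if w = 0 then block \<sigma> 1 (int s - 1) @ block \<sigma> (2 * int s - 1) (- int s - 1)
            @ skip_up s n @ block \<sigma> (- int s) (- 2)
     else if w = s - 1 then block \<sigma> 1 (- int s - 1)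
     else if w = s then skip_down s n @ block \<sigma> 1 (- 2)
     else block \<sigma> 1 (- 2))"
proof -
  have q0: "0 < q" using q_ge by simp
  have c0: "[k = s + 2] (mod (2 * s - 1)) \<longleftrightarrow> w = 0"
    using cong_index[OF assms(1,2) q0] assms(3) by simp
  have "[k = r] (mod (2 * s - 1)) \<longleftrightarrow> w = r - (s + 2)" if "r \<in> {s + 3..2 * s}" for r
  proof -
    have "r - (s + 2) < q" "s + 2 + (r - (s + 2)) = r" using that q_eq by auto
    with cong_index[OF assms(1,2) this(1)] show ?thesis using assms(3) by metis
  qed
  then have c1: "(\<exists>r\<in>{s + 3..2 * s}. [k = r] (mod (2 * s - 1))) \<longleftrightarrow> (\<exists>r\<in>{s + 3..2 * s}. w = r - (s + 2))"
    by simp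
  have c1': "(\<exists>r\<in>{s + 3..2 * s}. w = r - (s + 2)) \<longleftrightarrow> 1 \<le> w \<and> w + 2 \<le> s"
  proof
    show "1 \<le> w \<and> w + 2 \<le> s" if "\<exists>r\<in>{s + 3..2 * s}. w = r - (s + 2)" using that by auto
    show "\<exists>r\<in>{s + 3..2 * s}. w = r - (s + 2)" if "1 \<le> w \<and> w + 2 \<le> s"
      using that by (intro bexI[of _ "s + 2 + w"]) auto
  qed
  have e: "[k = 2] (mod q) \<longleftrightarrow> [k = 2 + q] (mod q)" "[k = 3] (mod q) \<longleftrightarrow> [k = 3 + q] (mod q)"
    by (simp_all only: cong_def mod_add_self2)
  have q': "2 * s - 1 = q" using q_eq by simp
  have c2: "[k = 2] (mod (2 * s - 1)) \<longleftrightarrow> w = s - 1"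
  proof -
    have "s - 1 < q" "s + 2 + (s - 1) = 2 + q" using s3 q_eq by auto
    then show ?thesis using cong_index[OF assms(1,2), of "s - 1"] assms(3) e q' by metis
  qed
  have c3: "[k = 3] (mod (2 * s - 1)) \<longleftrightarrow> w = s"
  proof -
    have "s < q" "s + 2 + s = 3 + q" using s3 q_eq by auto
    then show ?thesis using cong_index[OF assms(1,2), of s] assms(3) e q' by metis
  qed
  show ?thesis
    unfolding T_tail_def c0 c1 c1' c2 c3 using assms(3,4) s3 by auto
qed

lemma skip_eq: "skip_up s n = [m + 1..<n + 1]" "skip_down s n = rev [m + 1..<n + 1]"
proof -
  have "n - s + 2 = m + 1" using n_eq m_eq by linarith
  then show "skip_up s n = [m + 1..<n + 1]" by (simp add: skip_up_def)
  then show "skip_down s n = rev [m + 1..<n + 1]" by (simp add: skip_down_def)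
qed

section \<open>The closed form satisfies the recursion\<close>

lemma last_form_late:
  assumes "i + 2 \<le> s"
  shows "last (form (n - s + i)) = m + 1 + i"
proof (cases "i = 0")
  case True
  then show ?thesis using form_end m_eq s3 by (simp add: last_append last_rev hd_append)
next
  case False
  have "m + 1 + i < n + 1" using assms m_eq by linarith
  then show ?thesis using False form_late[of i]
    by (simp add: late_def last_append last_rev del: upt_Suc)
qed

lemma form_step_early:
  assumes "3 \<le> k" "k \<le> s + 1"
  shows "form k = (n + 3 - k) # block (form (k - 1)) 1 (- 2)"
proof -
  have k: "k < n" using assms n_eq by linarith
  have "[n + 3 - k..<n + 1] = (n + 3 - k) # [n + 3 - (k - 1)..<n + 1]"
  proof -
    have "n + 3 - (k - 1) = n + 4 - k" using assms by linarith
    then show ?thesis using assms k upt_Cons_diff[of n k "n + 1"] by (simp del: upt_Suc)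
  qed
  then show ?thesis using assms k
    by (simp add: form_early early_def block_butlast butlast_append_upt del: upt_Suc)
qed

text \<open>The recursion deletes exactly the old skip block and inserts the new one before the last
  \<open>s\<close> letters. For \<open>k = s + 2\<close> the old block is the beginning of an
  \<open>early\<close> term; otherwise it occupies the positions \<open>s\<close> to
  \<open>2 * s - 2\<close> of a \<open>down\<close> term.\<close>

lemma form_step_up0:
  assumes "u \<le> M" "k = s + 2 + u * q"
  shows "form k = (n + 3 - k) # T_tail s n k (form (k - 1))"
proof -
  have k: "k < n - s" "3 \<le> k" "u * q \<le> M * q" using assms q_eq n_eq s3 uq_le[OF assms(1)] by linarith+
  define c where "c = m - (s + 1 + u * q)"
  have c: "c + k = m + 1" "0 < c" unfolding c_def using assms k m_eq n_eq q_eq s3 by linarith+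
  have fk: "form k = up c k" unfolding c_def using form_up[OF assms(1), of 0 k] assms s3 by simp
  have up: "up c k = (n + 3 - k) # [n + 4 - k..<m + 1] @ [1..<c + 1] @ [m + 1..<n + 1] @ [c + 1..<n + 2 - k]"
  proof -
    have "n + 3 - k < m + 1" using assms(2) m_eq n_eq by linarith
    then have "[n + 3 - k..<m + 1] = (n + 3 - k) # [n + 4 - k..<m + 1]"
      using k upt_Cons_diff[of n k] by (simp del: upt_Suc)
    then show ?thesis by (simp add: up_def del: upt_Suc)
  qed
  have tail: "T_tail s n k \<sigma> =
    (if k = s + 2 then block \<sigma> (int s) (- int s - 1) @ skip_up s n @ block \<sigma> (- int s) (- 2)
     else block \<sigma> 1 (int (s - 1)) @ block \<sigma> (int (2 * s - 1)) (- int s - 1)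
            @ skip_up s n @ block \<sigma> (- int s) (- 2))" for \<sigma>
    using tail_index[OF assms(1), of 0 k \<sigma>] assms k q_ge s3 by simp
  show ?thesis
  proof (cases "u = 0")
    case True
    then have ks: "k = s + 2" using assms by simp
    define X Y where "X = [m + 1..<n + 1]" and "Y = [1..<c + 1]"
    have f: "form (k - 1) = X @ Y @ [c + 1..<m]"
    proof -
      have "[1..<c + 1] @ [c + 1..<m] = [1..<m]"
        using c ks s3 by (intro upt_add_append) linarith+
      moreover have "n + 3 - (s + 1) = m + 1" "n + 2 - (s + 1) = m" using m_eq by linarith+
      ultimately show ?thesis using ks unfolding X_def Y_def
        by (simp add: form_early early_def del: upt_Suc)
    qed
    have lX: "length X = s - 1" using m_eq X_def by (simp del: upt_Suc)
    have lZ: "length [c + 1..<m] = s" using c ks by (simp del: upt_Suc)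
    have b1: "block (form (k - 1)) (int s) (- int s - 1) = Y"
      using s3 lX lZ unfolding f by (subst block_drop_end) (simp_all del: upt_Suc)
    have b2: "block (form (k - 1)) (- int s) (- 2) = [c + 1..<m - 1]"
    proof -
      have "butlast (X @ Y @ [c + 1..<m]) = (X @ Y) @ [c + 1..<m - 1]"
        using butlast_append_upt[of "c + 1" m "X @ Y"] lZ s3 by (simp del: upt_Suc)
      then show ?thesis
        using s3 lX lZ unfolding f by (subst block_suffix) (simp_all del: upt_Suc)
    qed
    have e: "[n + 4 - k..<m + 1] = []" "n + 2 - k = m - 1" using ks m_eq by auto
    show ?thesis unfolding fk up tail b1 b2 e skip_eq Y_def using ks by simp
  next
    case False
    then obtain u' where u': "u = Suc u'" using not0_implies_Suc by blast
    \<comment> \<open>The previous term is the last of its \<open>down\<close> run, where exactly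
      \<open>s - 1\<close> letters are left in front of the skip block.\<close>
    have "k - 1 = 2 * s + 2 + u' * q + (s - 2)" using assms u' q_eq s3 by simp
    then have "form (k - 1) = down (n + 1 - (2 * s + u' * q)) (k - 1)"
      using form_down[of u' "s - 2" "k - 1"] assms u' s3 by simp
    moreover define d where "d = n + 1 - (2 * s + u' * q)"
    ultimately have f0: "form (k - 1) = down d (k - 1)" by simp
    have d: "d + k = n + 2 + s" "d < m" using d_def assms u' q_eq k n_eq m_eq s3 by auto
    define X Y where "X = [n + 4 - k..<d + 1]" and "Y = [d + 1..<m + 1] @ [1..<c + 1]"
    have f: "form (k - 1) = X @ rev [m + 1..<n + 1] @ Y @ [c + 1..<n + 3 - k]"
    proof -
      have "[1..<c + 1] @ [c + 1..<n + 3 - k] = [1..<n + 3 - k]"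
        using c m_eq s3 by (intro upt_add_append) linarith+
      moreover have "n + 3 - (k - 1) = n + 4 - k" "n + 2 - (k - 1) = n + 3 - k" using k by linarith+
      ultimately show ?thesis unfolding f0 down_def X_def Y_def
        by (simp del: upt_Suc)
    qed
    have lX: "length X = s - 1" using d X_def k by (simp del: upt_Suc)
    have lU: "length (rev [m + 1..<n + 1]) = s - 1" using m_eq by (simp del: upt_Suc)
    have lZ: "length [c + 1..<n + 3 - k] = s" using c m_eq by (simp del: upt_Suc)
    have b0: "block (form (k - 1)) 1 (int (s - 1)) = X"
      unfolding block_take f using lX by (simp del: upt_Suc)
    have b1: "block (form (k - 1)) (int (2 * s - 1)) (- int s - 1) = Y"
      using s3 lX lU lZ unfolding f by (subst block_drop_end) (simp_all del: upt_Suc)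
    have b2: "block (form (k - 1)) (- int s) (- 2) = [c + 1..<n + 2 - k]"
    proof -
      have "butlast (X @ rev [m + 1..<n + 1] @ Y @ [c + 1..<n + 3 - k])
          = (X @ rev [m + 1..<n + 1] @ Y) @ [c + 1..<n + 2 - k]"
        using butlast_append_upt[of "c + 1" "n + 3 - k" "X @ rev [m + 1..<n + 1] @ Y"] lZ s3
        by (simp del: upt_Suc)
      then show ?thesis
        using s3 lX lU lZ unfolding f by (subst block_suffix) (simp_all del: upt_Suc)
    qed
    have e: "[n + 4 - k..<m + 1] = [n + 4 - k..<d + 1] @ [d + 1..<m + 1]"
      using d k s3 by (intro upt_add_append[symmetric]) linarith+
    have "k \<noteq> s + 2" using assms u' q_ge by simp
    then show ?thesis unfolding fk up tail b0 b1 b2 e skip_eq X_def Y_def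
      by (simp del: upt_Suc)
  qed
qed

text \<open>Inside a run the skip block stays behind the same letter \<open>c\<close>: one letter is
  gained at the front and one is lost at the end, and the end is not yet used up.\<close>

lemma form_step_butlast:
  assumes "u \<le> M" "k = s + 2 + u * q + w" "w < q" "w \<notin> {0, s - 1, s}"
  shows "form k = (n + 3 - k) # T_tail s n k (form (k - 1))"
proof -
  have "0 < w" using assms(4) by simp
  then have k: "k < n - s" "s + 2 < k" "u * q \<le> M * q" using assms q_eq n_eq s3 uq_le[OF assms(1)] by linarith+
  have tail: "T_tail s n k \<sigma> = butlast \<sigma>" for \<sigma>
    using tail_index[OF assms(1,3,2) k(1)] assms(4) k by (simp add: block_butlast)
  have e: "n + 3 - (k - 1) = n + 4 - k" "n + 2 - (k - 1) = n + 3 - k" using k by linarith+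
  have e1: "n + 3 - k - 1 = n + 2 - k" by linarith
  consider (up) "w + 2 \<le> s" | (down) "s + 1 \<le> w" using assms(4) by auto linarith
  then show ?thesis
  proof cases
    case up
    define c where "c = m - (s + 1 + u * q)"
    have w: "1 \<le> w" using assms(4) by simp
    have fk: "form k = up c k" unfolding c_def using form_up assms up by blast
    have "k - 1 = s + 2 + u * q + (w - 1)" "w - 1 + 2 \<le> s" using assms up w by linarith+
    then have fk1: "form (k - 1) = up c (k - 1)" unfolding c_def using form_up assms up by blast
    have "n + 3 - k < m + 1" using k m_eq n_eq by linarith
    then have h: "[n + 3 - k..<m + 1] = (n + 3 - k) # [n + 4 - k..<m + 1]"
      using k upt_Cons_diff[of n k] by (simp del: upt_Suc)
    have "c + 1 < n + 3 - k" unfolding c_def using k assms up n_eq m_eq s3 q_eq by linarith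
    then show ?thesis unfolding tail fk fk1 up_def e h
      using butlast_append_upt[of "c + 1" "n + 3 - k" "[n + 4 - k..<m + 1] @ [1..<c + 1] @ [m + 1..<n + 1]"] e1
      by (simp del: upt_Suc)
  next
    case down
    define c where "c = n + 1 - (2 * s + u * q)"
    have "k = 2 * s + 2 + u * q + (w - s)" "w - s + 2 \<le> s" using assms down q_eq by linarith+
    then have fk: "form k = down c k" unfolding c_def using form_down assms down by blast
    have "k - 1 = 2 * s + 2 + u * q + (w - s - 1)" "w - s - 1 + 2 \<le> s" using assms down q_eq by linarith+
    then have fk1: "form (k - 1) = down c (k - 1)" unfolding c_def using form_down assms down by blast
    have "n + 3 - k < c + 1" unfolding c_def using k assms(2) down n_eq by linarith
    then have h: "[n + 3 - k..<c + 1] = (n + 3 - k) # [n + 4 - k..<c + 1]"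
      using k upt_Cons_diff[of n k] by (simp del: upt_Suc)
    have "1 < n + 3 - k" using k by linarith
    then show ?thesis unfolding tail fk fk1 down_def e h
      using butlast_append_upt[of "1" "n + 3 - k" "[n + 4 - k..<c + 1] @ rev [m + 1..<n + 1] @ [c + 1..<m + 1]"] e1
      by (simp del: upt_Suc)
  qed
qed

lemma form_step_bare:
  assumes "u \<le> M" "k = s + 2 + u * q + (s - 1)"
  shows "form k = (n + 3 - k) # T_tail s n k (form (k - 1))"
proof -
  have k: "k < n - s" "s + 2 < k" using assms q_eq n_eq s3 uq_le[OF assms(1)] by linarith+
  have w: "s - 1 < q" using q_eq s3 by linarith
  have tail: "T_tail s n k \<sigma> = take (length \<sigma> - s) \<sigma>" for \<sigma>
    using tail_index[OF assms(1) w assms(2) k(1)] k s3 by (simp add: block_drop_end[of 1, simplified])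
  have e: "n + 3 - (k - 1) = n + 4 - k" "n + 2 - (k - 1) = n + 3 - k" using k by linarith+
  define c where "c = m - (s + 1 + u * q)"
  have "k - 1 = s + 2 + u * q + (s - 2)" "s - 2 + 2 \<le> s" using assms s3 by linarith+
  then have fk1: "form (k - 1) = up c (k - 1)" unfolding c_def using form_up assms by blast
  \<comment> \<open>The last term of an \<open>up\<close> run has a single letter behind its skip
    block, so cutting off \<open>s\<close> letters removes just the block and that letter.\<close>
  have c: "c + 1 = n + 2 - k" unfolding c_def using k assms(2) n_eq m_eq s3 q_eq by linarith
  have "n + 3 - k < m + 1" using k m_eq n_eq by linarith
  then have h: "[n + 3 - k..<m + 1] = (n + 3 - k) # [n + 4 - k..<m + 1]"
    using k upt_Cons_diff[of n k] by (simp del: upt_Suc)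
  have l: "length ([m + 1..<n + 1] @ [n + 2 - k..<n + 3 - k]) = s"
    using k m_eq s3 by (simp del: upt_Suc)
  show ?thesis unfolding tail fk1 up_def e form_bare[OF assms] bare_def h c
    using take_diff_append[OF l, of "[n + 4 - k..<m + 1] @ [1..<n + 2 - k]"]
    by (simp del: upt_Suc)
qed

lemma form_step_down0:
  assumes "u \<le> M" "k = 2 * s + 2 + u * q"
  shows "form k = (n + 3 - k) # T_tail s n k (form (k - 1))"
proof -
  have k: "k < n - s" "s + 2 < k" using assms q_eq n_eq s3 uq_le[OF assms(1)] by linarith+
  have w: "s < q" "k = s + 2 + u * q + s" using q_eq s3 assms by linarith+
  have tail: "T_tail s n k \<sigma> = rev [m + 1..<n + 1] @ butlast \<sigma>" for \<sigma>
    using tail_index[OF assms(1) w k(1), of \<sigma>] k s3 unfolding block_butlast skip_eq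
    by (auto split: if_splits simp del: upt_Suc)
  have e: "n + 3 - (k - 1) = n + 4 - k" "n + 2 - (k - 1) = n + 3 - k" using k by linarith+
  have e1: "n + 3 - k - 1 = n + 2 - k" by linarith
  \<comment> \<open>The new block stands directly behind the first letter, which therefore is the
    \<open>c\<close> of the whole run.\<close>
  have "n + 1 - (2 * s + u * q) = n + 3 - k" using assms(2) by linarith
  then have fk: "form k = down (n + 3 - k) k" using form_down[OF assms(1), of 0 k] assms(2) s3 by simp
  have "k - 1 = s + 2 + u * q + (s - 1)" using assms(2) s3 by linarith
  then have fk1: "form (k - 1) = bare (k - 1)" using form_bare assms by blast
  have h': "n + 3 - k + 1 = n + 4 - k" using k by linarith
  have h: "[n + 3 - k..<n + 4 - k] = [n + 3 - k]"
    using k upt_Cons_diff[of n k "n + 4 - k"] by simp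
  have "1 < n + 3 - k" using k by linarith
  then show ?thesis unfolding tail fk fk1 bare_def down_def e h' h
    using butlast_append_upt[of "1" "n + 3 - k" "[n + 4 - k..<m + 1]"] e1
    by (simp del: upt_Suc)
qed

text \<open>Term \<open>n - s - 1\<close> is the last \<open>down\<close> term of period
  \<open>M\<close>, with \<open>c = 2 * s + 2\<close>. Its skip block again occupies the positions
  \<open>s\<close> to \<open>2 * s - 2\<close> and is moved to the end.\<close>

lemma form_step_end: "form (n - s) = (s + 3) # T_tail s n (n - s) (form (n - s - 1))"
proof -
  define k where "k = n - s"
  have k: "k + s = n" "s + 2 < k" using k_def n_eq s3 by linarith+
  define c where "c = n + 1 - (2 * s + M * q)"
  have c: "c = 2 * s + 2" "c < m" using c_def n_eq m_eq s3 by linarith+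
  have "k - 1 = 2 * s + 2 + M * q + (s - 2)" "s - 2 + 2 \<le> s" using k_def n_eq s3 by linarith+
  then have "form (k - 1) = down c (k - 1)" unfolding c_def using form_down by blast
  moreover have e: "n + 3 - (k - 1) = s + 4" "n + 2 - (k - 1) = s + 3" using k by linarith+
  ultimately have f: "form (k - 1) = [s + 4..<c + 1] @ rev [m + 1..<n + 1] @ ([c + 1..<m + 1] @ [1..<s + 3])"
    by (simp add: down_def del: upt_Suc)
  have tail: "T_tail s n k \<sigma> = take (s - 1) \<sigma> @ drop (2 * s - 2) (butlast \<sigma>) @ rev [m + 1..<n + 1]" for \<sigma>
  proof -
    have "block \<sigma> (2 * int s - 1) (- 2) = drop (2 * s - 2) (butlast \<sigma>)"
      using block_drop_end[of "2 * s - 1" \<sigma> 1] s3 by (simp add: butlast_conv_take numeral_2_eq_2)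
    then show ?thesis using block_take[of \<sigma> "s - 1"] k s3 n_eq
      unfolding T_tail_def k_def skip_eq by simp
  qed
  have lX: "length [s + 4..<c + 1] = s - 1" using c by (simp del: upt_Suc)
  have lU: "length (rev [m + 1..<n + 1]) = s - 1" using m_eq by (simp del: upt_Suc)
  have bl: "butlast (form (k - 1)) = ([s + 4..<c + 1] @ rev [m + 1..<n + 1]) @ ([c + 1..<m + 1] @ [1..<s + 2])"
    unfolding f
    using butlast_append_upt[of 1 "s + 3" "[s + 4..<c + 1] @ rev [m + 1..<n + 1] @ [c + 1..<m + 1]"]
    by (simp del: upt_Suc)
  have d: "drop (2 * s - 2) (butlast (form (k - 1))) = [c + 1..<m + 1] @ [1..<s + 2]"
    unfolding bl by (rule drop_append_length) (use lX lU s3 in \<open>simp del: upt_Suc\<close>)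
  have t: "take (s - 1) (form (k - 1)) = [s + 4..<c + 1]"
    unfolding f by (rule take_append_length) (rule lX)
  have "[s + 3..<m + 1] = (s + 3) # [s + 4..<m + 1]"
    using c s3 by (simp add: upt_conv_Cons del: upt_Suc)
  moreover have "[s + 4..<c + 1] @ [c + 1..<m + 1] = [s + 4..<m + 1]"
    using c s3 by (intro upt_add_append) linarith+
  ultimately show ?thesis unfolding k_def[symmetric] form_end[folded k_def] tail t d by (simp del: upt_Suc)
qed

lemma form_step_late:
  assumes "1 \<le> i" "i \<le> s"
  shows "form (n - s + i) = last (form (n - s + i - 2)) # T_tail s n (n - s + i) (form (n - s + i - 1))"
proof -
  have n: "s + 2 < n - s" using n_eq s3 by linarith
  have tail: "T_tail s n (n - s + i) \<sigma> = (if i < s then butlast \<sigma> else \<sigma>)" for \<sigma>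
    using n assms unfolding T_tail_def block_butlast by auto
  show ?thesis
  proof (cases "i = 1")
    case True
    \<comment> \<open>Term \<open>n - s - 1\<close> still obeys \<open>last_form\<close>; from
      \<open>i = 2\<close> on, the letter put in front is a skip letter.\<close>
    have l: "last (form (n - s + i - 2)) = s + 2"
      using last_form[of "n - s + i - 2"] n True by (simp add: Suc_diff_le)
    have "m + 1 < n + 1" using m_eq s3 by linarith
    then have "butlast (rev [m + 1..<n + 1]) = rev [m + 2..<n + 1]"
      using butlast_rev_upt[of "m + 1" "n + 1"] by (simp del: upt_Suc)
    moreover have "[s + 2..<m + 1] = (s + 2) # [s + 3..<m + 1]"
      using m_eq n_eq by (simp add: upt_conv_Cons numeral_3_eq_3 del: upt_Suc)
    moreover have "rev [m + 1..<n + 1] \<noteq> []" using m_eq s3 by (simp del: upt_Suc)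
    ultimately show ?thesis unfolding tail l using True form_end form_late[of 1] s3
      by (simp add: late_def butlast_append del: upt_Suc)
  next
    case False
    then have i: "2 \<le> i" using assms by simp
    have e: "n - s + i - 2 = n - s + (i - 2)" "n - s + i - 1 = n - s + (i - 1)" using i by linarith+
    have l: "last (form (n - s + i - 2)) = m + i - 1"
      unfolding e using last_form_late[of "i - 2"] i assms by simp
    have f1: "form (n - s + i - 1) = late (i - 1)" unfolding e using form_late[of "i - 1"] i by simp
    have f: "form (n - s + i) = late i" using form_late assms by simp
    have h: "rev [m + 1..<m + i] = (m + i - 1) # rev [m + 1..<m + (i - 1)]"
    proof -
      have "Suc (m + i - 1) = m + i" "m + (i - 1) = m + i - 1" "m + 1 \<le> m + i - 1" using i by linarith+
      then show ?thesis using rev_upt_Cons[of "m + 1" "m + i - 1"] by metis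
    qed
    define X where "X = rev [m + 1..<m + (i - 1)] @ [s + 2..<m + 1] @ [1..<s + 2]"
    have "m + 1 + (i - 1) = m + i" using i by simp
    then have f1: "form (n - s + i - 1) = X @ rev [m + i..<n + 1]"
      unfolding f1 late_def X_def by (simp del: upt_Suc)
    have f: "form (n - s + i) = (m + i - 1) # X @ rev [m + 1 + i..<n + 1]"
      unfolding f late_def h X_def by (simp del: upt_Suc)
    show ?thesis
    proof (cases "i < s")
      case True
      then have "m + i < n + 1" using m_eq by linarith
      then have "butlast (rev [m + i..<n + 1]) = rev [m + 1 + i..<n + 1]" "rev [m + i..<n + 1] \<noteq> []"
        using butlast_rev_upt[of "m + i" "n + 1"] by (simp_all del: upt_Suc)
      then show ?thesis unfolding tail l f f1 using True by (simp only: butlast_append if_True if_False)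
    next
      case False
      \<comment> \<open>For \<open>i = s\<close> no skip letter is left at the end, so
        \<open>late\<close> agrees with the last rule, which deletes nothing.\<close>
      have "[m + i..<n + 1] = []" "[m + 1 + i..<n + 1] = []"
        using False assms m_eq by (auto simp del: upt_Suc)
      then show ?thesis unfolding tail l f f1 using False by (simp only: if_False)
    qed
  qed
qed

lemma form_step:
  assumes "3 \<le> k" "k \<le> n"
  shows "form k = last (form (k - 2)) # T_tail s n k (form (k - 1))"
proof -
  consider "k \<le> s + 1" | "s + 1 < k" "k < n - s" | "k = n - s" | "n - s < k" by linarith
  then show ?thesis
  proof cases
    case 1
    have "last (form (k - 2)) = n + 3 - k" using last_form[of "k - 2"] 1 assms n_eq by simp
    then show ?thesis using form_step_early 1 assms by (simp add: T_tail_def)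
  next
    case 2
    then have "last (form (k - 2)) = n + 3 - k" using last_form[of "k - 2"] assms by simp
    moreover from 2 have "form k = (n + 3 - k) # T_tail s n k (form (k - 1))"
    proof (cases rule: mid_cases)
      case (up u v)
      then show ?thesis using form_step_up0[of u k] form_step_butlast[of u k v] q_eq s3
        by (cases "v = 0") auto
    next
      case (bare u)
      then show ?thesis by (rule form_step_bare)
    next
      case (down u v)
      then show ?thesis using form_step_down0[of u k] form_step_butlast[of u k "s + v"] q_eq s3
        by (cases "v = 0") auto
    qed
    ultimately show ?thesis by simp
  next
    case 3
    have "last (form (k - 2)) = s + 3" using last_form[of "k - 2"] assms 3 n_eq by simp
    then show ?thesis using 3 form_step_end by simp
  next
    case 4
    then show ?thesis using form_step_late[of "k - (n - s)"] assms by simp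
  qed
qed

text \<open>\<open>element_minus1\<close> asks for a nonempty list when the recursion is read with
  \<open>last\<close>.\<close>

lemma form_nonempty: "1 \<le> t \<Longrightarrow> t \<le> n \<Longrightarrow> form t \<noteq> []"
proof (cases "3 \<le> t")
  case False
  assume "1 \<le> t" "t \<le> n"
  moreover have "t < n - s" using False n_eq s3 by linarith
  ultimately show ?thesis using last_form by simp
next
  case True
  assume "t \<le> n"
  then show ?thesis using form_step[OF True] by (metis list.distinct(1))
qed

lemma T_seq_form: "1 \<le> t \<Longrightarrow> t \<le> n \<Longrightarrow> T_seq s n t = form t"
proof (induction t rule: less_induct)
  case (less t)
  consider "t = 1" | "t = 2" | j where "t = j + 3" using less.prems
    by (metis One_nat_def Suc_le_eq add.commute le_add_diff_inverse less_Suc_eq_le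
        nat_less_le numeral_2_eq_2 numeral_3_eq_3)
  then show ?case
  proof cases
    case 1 then show ?thesis by (simp add: form_early early_def)
  next
    case 2 then show ?thesis using s3 by (simp add: form_early early_def numeral_2_eq_2)
  next
    case 3
    then have "T_seq s n t = element (form (t - 2)) (- 1) # T_tail s n t (form (t - 1))"
      using less by (simp add: numeral_3_eq_3)
    then show ?thesis using form_step[of t] 3 less.prems form_nonempty[of "t - 2"] by (simp add: element_minus1)
  qed
qed

section \<open>Forward completeness\<close>

definition word where "word k = concat (map form [1..<k + 1])"

definition skips :: "nat list \<Rightarrow> nat" where "skips xs = length (filter (\<lambda>z. m < z) xs)"

definition before :: "nat \<Rightarrow> nat \<Rightarrow> bool" where "before c z \<longleftrightarrow> z \<noteq> c \<or> m < z"

text \<open>\<open>front t p\<close> is the part of term \<open>t\<close> in front of its last \<open>min t s - 1 - p\<close> letters from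
  \<open>{1..m}\<close>, the first of which is \<open>cut t p\<close>. For \<open>t \<le> s\<close> and \<open>p = t - 1\<close> it would be the
  skip letter \<open>m + 1\<close>; then nothing is dropped, which is why \<open>before\<close> lets every skip letter pass.\<close>

definition cut where "cut t p = m + 2 + p - t"

definition front where "front t p = takeWhile (before (cut t p)) (form t)"

definition rest where "rest t p = dropWhile (before (cut t p)) (form t)"

lemma word_Suc: "word (Suc k) = word k @ form (Suc k)"
  by (simp add: word_def)

lemma front_rest: "form t = front t p @ rest t p"
  by (simp add: front_def rest_def)

lemma filter_front:
  "filter (\<lambda>z. z \<le> m) (takeWhile (before c) xs) = takeWhile (\<lambda>z. z \<noteq> c) (filter (\<lambda>z. z \<le> m) xs)"
  by (induction xs) (auto simp: before_def)

lemma filter_rest: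
  "filter (\<lambda>z. z \<le> m) (dropWhile (before c) xs) = dropWhile (\<lambda>z. z \<noteq> c) (filter (\<lambda>z. z \<le> m) xs)"
  by (induction xs) (auto simp: before_def)

lemma filter_le_upt: "filter (\<lambda>z. z \<le> m) [a..<b] = [a..<min (m + 1) b]"
  by (induction b) (auto simp: min_def not_less_eq_eq)

text \<open>Once the skip block is gone, the two runs around it join up. The minimum is for
  \<open>t < s\<close>, where the final run of an \<open>early\<close> term reaches into the skip
  letters.\<close>

lemma filter_form:
  assumes "1 \<le> t" "t < n - s"
  shows "filter (\<lambda>z. z \<le> m) (form t) = [n + 3 - t..<m + 1] @ [1..<min (m + 1) (n + 2 - t)]"
proof (cases "t \<le> s + 1")
  case True
  then have "m + 1 \<le> n + 3 - t" "m + 1 \<le> n + 1" using m_eq s3 by linarith+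
  then show ?thesis using True
    by (simp add: form_early early_def filter_le_upt del: upt_Suc)
next
  case False
  then have l: "s + 1 < t" by simp
  have skip: "filter (\<lambda>z. z \<le> m) [m + 1..<n + 1] = []" "filter (\<lambda>z. z \<le> m) (rev [m + 1..<n + 1]) = []"
    by (auto simp: filter_empty_conv simp del: upt_Suc)
  from l have b: "n + 2 - t \<le> m + 1" using m_eq by linarith
  from l assms(2) show ?thesis
  proof (cases rule: mid_cases)
    case (up u v)
    define c where "c = m - (s + 1 + u * q)"
    have c: "1 \<le> c + 1" "c + 1 \<le> n + 2 - t" "c \<le> m"
      unfolding c_def using up assms m_eq s3 by linarith+
    then have "[1..<c + 1] @ [c + 1..<n + 2 - t] = [1..<n + 2 - t]" by (intro upt_add_append)
    then show ?thesis using form_up[OF up] skip b c unfolding c_def[symmetric] up_def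
      by (simp add: filter_le_upt del: upt_Suc)
  next
    case (bare u)
    then show ?thesis using form_bare[OF bare] b unfolding bare_def
      by (simp add: filter_le_upt del: upt_Suc)
  next
    case (down u v)
    define c where "c = n + 1 - (2 * s + u * q)"
    have c: "n + 3 - t \<le> c + 1" "c \<le> m"
      unfolding c_def using down assms m_eq s3 by linarith+
    then have "[n + 3 - t..<c + 1] @ [c + 1..<m + 1] = [n + 3 - t..<m + 1]" by (intro upt_add_append) auto
    then show ?thesis using form_down[OF down] skip b c unfolding c_def[symmetric] down_def
      by (simp add: filter_le_upt del: upt_Suc)
  qed
qed

section \<open>The letters up to \<open>m\<close> before and after the cut of a term\<close>

lemma cut_bounds:
  assumes "t < n - s" "p < s" "p < t"
  shows "1 \<le> cut t p" "cut t p \<le> m + 1" "cut t p \<le> n + 2 - t"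
  using assms m_eq unfolding cut_def by linarith+

lemma filter_front_form:
  assumes "1 \<le> t" "t < n - s" "p < s" "p < t"
  shows "filter (\<lambda>z. z \<le> m) (front t p) = [n + 3 - t..<m + 1] @ [1..<cut t p]"
proof -
  \<comment> \<open>As the cut is at most \<open>n + 2 - t\<close>, the first run is passed as a
    whole and the cut falls into the second.\<close>
  have "\<forall>z\<in>set [n + 3 - t..<m + 1]. z \<noteq> cut t p" using cut_bounds[OF assms(2-4)] by auto
  then show ?thesis
    unfolding front_def filter_front filter_form[OF assms(1,2)]
    using cut_bounds[OF assms(2-4)] by (subst takeWhile_append2) (auto simp: takeWhile_neq_upt simp del: upt_Suc)
qed

lemma filter_rest_form:
  assumes "1 \<le> t" "t < n - s" "p < s" "p < t"
  shows "filter (\<lambda>z. z \<le> m) (rest t p) = [cut t p..<min (m + 1) (n + 2 - t)]"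
proof -
  have "\<forall>z\<in>set [n + 3 - t..<m + 1]. z \<noteq> cut t p" using cut_bounds[OF assms(2-4)] by auto
  then show ?thesis
    unfolding rest_def filter_rest filter_form[OF assms(1,2)]
    using cut_bounds[OF assms(2-4)] by (subst dropWhile_append2) (auto simp: dropWhile_neq_upt simp del: upt_Suc)
qed

text \<open>Carries a last letter known only in the filtered list back to the list itself.\<close>

lemma split_at_last_nonskip:
  assumes "filter (\<lambda>z. z \<le> m) xs = zs @ [x]"
  shows "\<exists>ys ws. xs = ys @ x # ws \<and> (\<forall>z\<in>set ws. m < z)"
  using assms
proof (induction xs rule: rev_induct)
  case (snoc a xs)
  show ?case
  proof (cases "a \<le> m")
    case True
    then show ?thesis using snoc.prems by (intro exI[of _ xs] exI[of _ "[]"]) auto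
  next
    case False
    then obtain ys ws where "xs = ys @ x # ws" "\<forall>z\<in>set ws. m < z" using snoc by auto
    then show ?thesis using False by (intro exI[of _ ys] exI[of _ "ws @ [a]"]) auto
  qed
qed simp

text \<open>\<open>reachable t p y x\<close>: once a prefix ending in \<open>y\<close> is embedded before the cut of term \<open>t\<close>,
  the letter \<open>x\<close> can be appended before the cut of term \<open>t + 1\<close>. The part \<open>ws\<close> free of \<open>y\<close> is not
  used by the embedding, so \<open>x\<close> may also be taken from there.\<close>

definition reachable where
  "reachable t p y x \<longleftrightarrow> (\<exists>vs ws. front t p = vs @ ws \<and> y \<notin> set ws \<and>
     x \<in> set ws \<union> set (rest t p) \<union> set (front (Suc t) (p + skips [y])))"

section \<open>One step of the greedy embedding\<close>

lemma reachableI1: "x \<in> set (rest t p) \<Longrightarrow> reachable t p y x"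
  unfolding reachable_def by (intro exI[of _ "front t p"] exI[of _ "[]"]) simp

lemma reachableI2: "x \<in> set (front (Suc t) (p + skips [y])) \<Longrightarrow> reachable t p y x"
  unfolding reachable_def by (intro exI[of _ "front t p"] exI[of _ "[]"]) simp

lemma reachableI3: "front t p = vs @ ws \<Longrightarrow> y \<notin> set ws \<Longrightarrow> x \<in> set ws \<Longrightarrow> reachable t p y x"
  unfolding reachable_def by blast

text \<open>From term \<open>t\<close> to \<open>t + 1\<close> the cut keeps its value if
  \<open>y\<close> is a skip letter and drops by one otherwise. So the only letter that could be
  missed is the one just before the cut of term \<open>t\<close>, and then \<open>y\<close> is no
  skip letter. Behind that letter the front has only skip letters, so \<open>y\<close> does not
  occur from there on and the letter is still free.\<close>

lemma reachable_nonskip: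
  assumes "1 \<le> t" "Suc t < n - s" "p < t" "p + skips [y] < s" "1 \<le> x" "x \<le> m" "x \<noteq> y"
  shows "reachable t p y x"
proof -
  have p: "p < s" "p + skips [y] < Suc t" using assms by (auto simp: skips_def split: if_splits)
  have x: "x \<in> set xs \<longleftrightarrow> x \<in> set (filter (\<lambda>z. z \<le> m) xs)" for xs using assms by simp
  have f: "x \<in> set (front (Suc t) (p + skips [y])) \<longleftrightarrow> n + 2 - t \<le> x \<or> x < cut (Suc t) (p + skips [y])"
    using x[of "front (Suc t) (p + skips [y])"] filter_front_form[of "Suc t"] assms p by auto
  have b: "x \<in> set (rest t p) \<longleftrightarrow> cut t p \<le> x \<and> x < n + 2 - t"
    using x[of "rest t p"] filter_rest_form[of t p] assms p by auto
  consider "x \<in> set (rest t p)" | "x \<in> set (front (Suc t) (p + skips [y]))"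
    | "cut (Suc t) (p + skips [y]) \<le> x" "x < cut t p" using f b by linarith
  then show ?thesis
  proof cases
    case 3
    then have y: "y \<le> m" "x + 1 = cut t p" using assms m_eq
      by (auto simp: cut_def skips_def split: if_splits)
    then have "filter (\<lambda>z. z \<le> m) (front t p) = ([n + 3 - t..<m + 1] @ [1..<x]) @ [x]"
      using filter_front_form[of t p] assms p by (simp add: y(2)[symmetric])
    from split_at_last_nonskip[OF this] obtain ys ws
      where w: "front t p = ys @ x # ws" "\<forall>z\<in>set ws. m < z" by blast
    then have "y \<notin> set (x # ws)" using y assms by auto
    then show ?thesis using w by (intro reachableI3) auto
  qed (auto intro: reachableI1 reachableI2)
qed

lemma front_prefix: "\<forall>z\<in>set xs. before (cut t p) z \<Longrightarrow> form t = xs @ ys \<Longrightarrow> set xs \<subseteq> set (front t p)"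
  unfolding front_def by simp

lemma rest_suffix: "z \<in> set xs \<Longrightarrow> \<not> before (cut t p) z \<Longrightarrow> form t = xs @ ys \<Longrightarrow> set ys \<subseteq> set (rest t p)"
  unfolding rest_def by (simp add: dropWhile_append1)

text \<open>The skip letters from \<open>n + 2 - t\<close> on stand at the beginning of term
  \<open>t + 1\<close>, the smaller ones at the end of term \<open>t\<close>. The latter lie behind
  the cut unless \<open>p + 1 = t\<close>, when nothing is cut off and the order of \<open>x\<close>
  and \<open>y\<close> in the final block decides.\<close>

lemma reachable_skip_early:
  assumes "1 \<le> t" "t \<le> s" "p < t" "m < x" "x \<le> n" "x \<noteq> y" "y \<le> n" "p + skips [y] + 1 < s"
  shows "reachable t p y x"
proof -
  have f: "form t = ([n + 3 - t..<n + 1] @ [1..<m + 1]) @ [m + 1..<n + 2 - t]"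
  proof -
    have "[1..<m + 1] @ [m + 1..<n + 2 - t] = [1..<n + 2 - t]"
      using assms m_eq s3 by (intro upt_add_append) linarith+
    then show ?thesis using assms(2) by (simp add: form_early early_def del: upt_Suc)
  qed
  have f': "form (Suc t) = [n + 2 - t..<n + 1] @ [1..<n + 1 - t]"
  proof -
    have "n + 3 - Suc t = n + 2 - t" "n + 2 - Suc t = n + 1 - t" by linarith+
    then show ?thesis using assms(2) by (simp add: form_early early_def del: upt_Suc)
  qed
  have tn: "t < n - s" "t < m" "1 < m" using assms n_eq m_eq s3 by linarith+
  have cb: "1 \<le> cut t p" "cut t p \<le> m + 1" using cut_bounds[OF tn(1) _ assms(3)] assms by linarith+
  show ?thesis
  proof (cases "n + 2 - t \<le> x")
    case True
    have "\<forall>z\<in>set [n + 2 - t..<n + 1]. before (cut (Suc t) (p + skips [y])) z"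
      using assms m_eq by (auto simp: before_def simp del: upt_Suc)
    from front_prefix[OF this f'] show ?thesis using True assms by (auto intro!: reachableI2 simp del: upt_Suc)
  next
    case x: False
    show ?thesis
    proof (cases "cut t p \<le> m")
      case True
      have "x \<in> set [m + 1..<n + 2 - t]" using x assms by (auto simp del: upt_Suc)
      moreover have "cut t p \<in> set ([n + 3 - t..<n + 1] @ [1..<m + 1])"
        using cb True by (auto simp del: upt_Suc)
      ultimately show ?thesis
        using rest_suffix[OF _ _ f, of "cut t p" p] True by (auto simp: before_def intro!: reachableI1)
    next
      case False
      then have p: "p + 1 = t" using cb assms tn by (simp add: cut_def)
      have "takeWhile (before (cut t p)) (form t) = form t"
        using False by (intro takeWhile_eq_all_conv[THEN iffD2]) (auto simp: before_def)
      then have front: "front t p = form t" by (simp add: front_def)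
      consider "y \<notin> set [m + 1..<n + 2 - t]" | "m < y" "y < n + 2 - t" "y < x" | "m < y" "y < n + 2 - t" "x < y"
        using assms by force
      then show ?thesis
      proof cases
        case 1
        then show ?thesis using x assms by (intro reachableI3[OF trans[OF front f]]) (auto simp del: upt_Suc)
      next
        case 2
        have "[m + 1..<n + 2 - t] = [m + 1..<y + 1] @ [y + 1..<n + 2 - t]"
          using 2 by (intro upt_add_append[symmetric]) linarith+
        then have "front t p = ([n + 3 - t..<n + 1] @ [1..<m + 1] @ [m + 1..<y + 1]) @ [y + 1..<n + 2 - t]"
          using front f by simp
        then show ?thesis by (rule reachableI3) (use 2 x in auto)
      next
        case 3
        have "x \<in> set (form (Suc t))" using 3 assms unfolding f' by (auto simp del: upt_Suc)
        \<comment> \<open>Since \<open>y\<close> is a skip letter too, the cut of term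
          \<open>t + 1\<close> is again \<open>m + 1\<close>, and the whole term is
          available.\<close>
        moreover have "cut (Suc t) (p + skips [y]) = m + 1" using 3 p tn by (simp add: cut_def skips_def)
        then have "takeWhile (before (cut (Suc t) (p + skips [y]))) (form (Suc t)) = form (Suc t)"
          by (intro takeWhile_eq_all_conv[THEN iffD2]) (auto simp: before_def)
        then have "front (Suc t) (p + skips [y]) = form (Suc t)" by (simp only: front_def)
        ultimately show ?thesis by (intro reachableI2) simp
      qed
    qed
  qed
qed

text \<open>Either the skip block of term \<open>t\<close> lies behind its cut, or the block of term
  \<open>t + 1\<close> lies before its cut. In the one case between, the front of term
  \<open>t\<close> ends with its skip block and \<open>y\<close> is no skip letter, so the block is
  free. The alternative \<open>c = n - t\<close> covers a term \<open>t + 1\<close> without skip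
  letters.\<close>

lemma reachable_skip_after_up:
  assumes "t < n - s" "s + 1 < t" "p + skips [y] + 1 < s" "x \<noteq> y" "m < x" "x \<le> n" "1 \<le> c"
    and t: "form t = up c t" "c < n + 1 - t"
    and next_term: "form (Suc t) = up c (Suc t) \<or> c = n - t"
  shows "reachable t p y x"
proof -
  define X where "X = [n + 3 - t..<m + 1] @ [1..<c + 1]"
  have f: "form t = X @ [m + 1..<n + 1] @ [c + 1..<n + 2 - t]"
    using t by (simp add: up_def X_def del: upt_Suc)
  have x: "x \<in> set [m + 1..<n + 1]" using assms by auto
  have cb: "1 \<le> cut t p" "cut t p \<le> n + 2 - t" "cut t p \<le> m"
    using cut_bounds[of t p] assms m_eq unfolding cut_def by linarith+
  consider "cut t p \<le> c" | "cut t p = c + 1" "y \<le> m" | "c + 1 \<le> cut (Suc t) (p + skips [y])"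
  proof -
    have "cut (Suc t) (p + skips [y]) = (if m < y then cut t p else cut t p - 1)"
      by (simp add: cut_def skips_def)
    then show thesis using that by (cases "m < y"; cases "cut t p \<le> c"; force)
  qed
  then show ?thesis
  proof cases
    case 1
    then have "cut t p \<in> set X" using cb by (auto simp: X_def)
    then show ?thesis using rest_suffix[OF _ _ f, of "cut t p" p] cb x
      by (auto simp: before_def intro!: reachableI1)
  next
    case 2
    have "\<forall>z\<in>set (X @ [m + 1..<n + 1]). before (cut t p) z"
      using 2 t by (auto simp: X_def before_def simp del: upt_Suc)
    moreover have "[c + 1..<n + 2 - t] = (c + 1) # [c + 2..<n + 2 - t]"
      using t by (simp add: upt_conv_Cons)
    moreover have "\<not> before (cut t p) (c + 1)" using 2 cb by (simp add: before_def)
    ultimately have "front t p = X @ [m + 1..<n + 1]" unfolding front_def f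
      by (simp add: takeWhile_append del: upt_Suc)
    then show ?thesis using 2 x by (intro reachableI3) auto
  next
    case 3
    \<comment> \<open>At most \<open>s - 2\<close> skip letters have been used, as \<open>x\<close>
      is a further one. With \<open>c\<close> below the cut this rules out
      \<open>c = n - t\<close>.\<close>
    have b: "cut (Suc t) (p + skips [y]) \<le> n - t" using assms m_eq by (simp add: cut_def)
    then have f': "form (Suc t) = ([n + 2 - t..<m + 1] @ [1..<c + 1] @ [m + 1..<n + 1]) @ [c + 1..<n + 1 - t]"
      using next_term 3 by (auto simp: up_def numeral_3_eq_3 simp del: upt_Suc)
    have "\<forall>z\<in>set ([n + 2 - t..<m + 1] @ [1..<c + 1] @ [m + 1..<n + 1]). before (cut (Suc t) (p + skips [y])) z"
      using b 3 by (auto simp: before_def simp del: upt_Suc)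
    from front_prefix[OF this f'] show ?thesis using x by (auto intro!: reachableI2 simp del: upt_Suc)
  qed
qed

lemma reachable_skip:
  assumes "1 \<le> t" "Suc t < n - s" "p < t" "p + skips [y] + 1 < s" "m < x" "x \<le> n" "x \<noteq> y" "y \<le> n"
  shows "reachable t p y x"
proof (cases "t \<le> s")
  case True
  then show ?thesis using assms by (intro reachable_skip_early)
next
  case False
  then have "s + 1 < Suc t" by simp
  from this assms(2) show ?thesis
  proof (cases rule: mid_cases)
    case (up u v)
    define c where "c = m - (s + 1 + u * q)"
    have f': "form (Suc t) = up c (Suc t)" unfolding c_def using up by (rule form_up)
    show ?thesis
    proof (cases "v = 0")
      case True
      \<comment> \<open>The smallest possible cut of term \<open>t + 1\<close> is
        \<open>c + 1\<close>, so at the start of an \<open>up\<close> run the skip block always lies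
        in the front.\<close>
      have c: "c = m - t" using True up by (simp add: c_def)
      have f': "form (Suc t) = ([n + 2 - t..<m + 1] @ [1..<c + 1] @ [m + 1..<n + 1]) @ [c + 1..<n + 1 - t]"
        using f' by (simp add: up_def numeral_3_eq_3 del: upt_Suc)
      have "\<forall>z\<in>set ([n + 2 - t..<m + 1] @ [1..<c + 1] @ [m + 1..<n + 1]). before (cut (Suc t) (p + skips [y])) z"
        using assms m_eq by (auto simp: before_def c cut_def simp del: upt_Suc)
      from front_prefix[OF this f'] show ?thesis using assms by (auto intro!: reachableI2 simp del: upt_Suc)
    next
      case False
      then have v: "v - 1 + 2 \<le> s" "t = s + 2 + u * q + (v - 1)" using up by linarith+
      have f: "form t = up c t" unfolding c_def using up(1) v by (rule form_up)
      show ?thesis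
      proof (rule reachable_skip_after_up[OF _ _ _ _ _ _ _ f])
        show "1 \<le> c" "c < n + 1 - t" unfolding c_def using v assms m_eq n_eq up by linarith+
      qed (use assms v f' in auto)
    qed
  next
    case (bare u)
    define c where "c = m - (s + 1 + u * q)"
    have v: "s - 2 + 2 \<le> s" "t = s + 2 + u * q + (s - 2)" using bare s3 by linarith+
    have f: "form t = up c t" unfolding c_def using bare(1) v by (rule form_up)
    have c: "c = n - t" using v m_eq s3 by (simp add: c_def)
    show ?thesis
    proof (rule reachable_skip_after_up[OF _ _ _ _ _ _ _ f])
      show "1 \<le> c" "c < n + 1 - t" unfolding c using v assms m_eq n_eq by linarith+
    qed (use assms v c in auto)
  next
    case (down u v)
    define c where "c = n + 1 - (2 * s + u * q)"
    have "form (Suc t) = down c (Suc t)" unfolding c_def using down by (rule form_down)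
    then have f': "form (Suc t) = ([n + 2 - t..<c + 1] @ rev [m + 1..<n + 1]) @ [c + 1..<m + 1] @ [1..<n + 1 - t]"
      by (simp add: down_def numeral_3_eq_3 del: upt_Suc)
    \<comment> \<open>The run before the block consists of letters larger than the cut.\<close>
    have "\<forall>z\<in>set ([n + 2 - t..<c + 1] @ rev [m + 1..<n + 1]). before (cut (Suc t) (p + skips [y])) z"
      using assms m_eq by (auto simp: before_def cut_def simp del: upt_Suc)
    from front_prefix[OF this f'] show ?thesis using assms by (auto intro!: reachableI2 simp del: upt_Suc)
  qed
qed

section \<open>Embedding of whole arrangements\<close>

lemma skips_append: "skips (xs @ ys) = skips xs + skips ys"
  by (simp add: skips_def)

lemma skips_le_length: "skips xs \<le> length xs"
  by (simp add: skips_def)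

lemma skips_less:
  assumes "distinct xs" "set xs \<subseteq> {1..n}"
  shows "skips xs < s"
proof -
  have "skips xs = card (set (filter (\<lambda>z. m < z) xs))"
    using assms distinct_card[of "filter (\<lambda>z. m < z) xs"] by (simp add: skips_def del: set_filter)
  also have "\<dots> \<le> card {m + 1..n}" using assms by (intro card_mono) auto
  finally show ?thesis using m_eq s3 by simp
qed

text \<open>The invariant of the greedy embedding. The last letter \<open>y\<close> does not count
  for the cut of its own term; \<open>reachable\<close> adds \<open>skips [y]\<close> only for the
  next one.\<close>

lemma embedded_in_front:
  assumes "distinct (\<rho> @ [y])" "set (\<rho> @ [y]) \<subseteq> {1..n}" "length \<rho> + 1 = t" "t < n - s"
  shows "subseq (\<rho> @ [y]) (word (t - 1) @ front t (skips \<rho>))"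
  using assms
proof (induction \<rho> arbitrary: y t rule: rev_induct)
  case Nil
  then have t: "t = 1" by simp
  \<comment> \<open>The cut of the first term is the skip letter \<open>m + 1\<close>, which
    \<open>before\<close> lets pass, so the front is the whole term.\<close>
  have "front t (skips []) = takeWhile (before (m + 1)) [1..<n + 1]"
    unfolding t by (simp add: front_def cut_def skips_def form_early early_def)
  also have "\<dots> = [1..<n + 1]"
    by (intro takeWhile_eq_all_conv[THEN iffD2]) (auto simp: before_def)
  finally have "front t (skips []) = [1..<n + 1]" .
  then show ?case using Nil by (auto simp: subseq_singleton_left simp del: upt_Suc)
next
  case (snoc y' \<rho>)
  define t' where "t' = t - 1"
  have t: "t = Suc t'" "length \<rho> + 1 = t'" "t' < n - s" "1 \<le> t'" using snoc.prems t'_def by auto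
  have IH: "subseq (\<rho> @ [y']) (word (t' - 1) @ front t' (skips \<rho>))"
    using snoc.prems t by (intro snoc.IH) auto
  have p: "skips \<rho> < t'" using skips_le_length[of \<rho>] t by simp
  have sk: "skips (\<rho> @ [y']) + skips [y] < s"
    using skips_less[of "(\<rho> @ [y']) @ [y]"] snoc.prems unfolding skips_append[of "\<rho> @ [y']"] by blast
  have sk': "skips (\<rho> @ [y']) < s" using skips_less[of "\<rho> @ [y']"] snoc.prems by auto
  have "reachable t' (skips \<rho>) y' y"
  proof (cases "y \<le> m")
    case True
    then show ?thesis using snoc.prems p t sk' by (intro reachable_nonskip) (auto simp: skips_append)
  next
    case False
    then have "skips [y] = 1" by (simp add: skips_def)
    then show ?thesis using False snoc.prems p t sk by (intro reachable_skip) (auto simp: skips_append)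
  qed
  then obtain vs ws where w: "front t' (skips \<rho>) = vs @ ws" "y' \<notin> set ws"
    "y \<in> set ws \<union> set (rest t' (skips \<rho>) @ front t (skips (\<rho> @ [y'])))"
    unfolding reachable_def t skips_append by auto
  have "word t' = word (t' - 1) @ front t' (skips \<rho>) @ rest t' (skips \<rho>)"
    using word_Suc[of "t' - 1"] t front_rest[of t' "skips \<rho>"] by simp
  moreover have "subseq (\<rho> @ [y', y]) ((word (t' - 1) @ vs) @ ws @ rest t' (skips \<rho>) @ front t (skips (\<rho> @ [y'])))"
    using IH w by (intro subseq_extend) simp_all
  moreover have "t - 1 = t'" by (simp add: t'_def)
  ultimately show ?case using w(1) by simp
qed

text \<open>The only letter that may be missing is \<open>s + 2\<close> for \<open>i = 0\<close> and
  \<open>m + i\<close> for \<open>0 < i < s\<close>, each time the last letter of the previous term;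
  term \<open>n\<close> contains every letter.\<close>

lemma late_letters:
  assumes "i \<le> s" "x \<in> {1..n}" "x \<noteq> last (form (n - s + i - 1))"
  shows "x \<in> set (form (n - s + i))"
proof (cases "i = 0")
  case True
  have "last (form (n - s - 1)) = s + 2"
  proof -
    have "1 \<le> n - s - 1" "n - s - 1 < n - s" "n + 1 - (n - s - 1) = s + 2"
      using n_eq s3 by linarith+
    then show ?thesis using last_form[of "n - s - 1"] by metis
  qed
  then have "x \<noteq> s + 2" using True assms(3) by simp
  then have "x \<in> set [s + 3..<m + 1] \<union> set [1..<s + 2] \<union> set [m + 1..<n + 1]"
    using assms(2) by auto
  then show ?thesis unfolding True add_0_right form_end by (simp del: upt_Suc)
next
  case False
  then have f: "form (n - s + i) = late i" by (intro form_late) simp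
  have n: "n = m + s - 1" using m_eq by simp
  have "x \<noteq> m + i \<or> i = s"
  proof (cases "i = s")
    case False
    then have "i - 1 + 2 \<le> s" "n - s + (i - 1) = n - s + i - 1" "m + 1 + (i - 1) = m + i"
      using assms(1) \<open>i \<noteq> 0\<close> by linarith+
    then show ?thesis using last_form_late[of "i - 1"] assms(3) by metis
  qed simp
  then consider "x \<le> s + 1" | "s + 2 \<le> x" "x \<le> m" | "m < x" "x < m + i" | "m + i < x"
    using assms n by fastforce
  then have "x \<in> set [m + 1..<m + i] \<union> set [s + 2..<m + 1] \<union> set [1..<s + 2] \<union> set [m + 1 + i..<n + 1]"
    using assms(2) by cases auto
  then show ?thesis unfolding f late_def by (simp del: upt_Suc)
qed

lemma arrangement_subseq_word:
  assumes "\<rho> \<in> arrangements {1..n} t" "t \<le> n"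
  shows "subseq \<rho> (word t)"
  using assms
proof (induction \<rho> arbitrary: t rule: rev_induct)
  case (snoc x \<rho>)
  then have \<rho>: "distinct (\<rho> @ [x])" "set (\<rho> @ [x]) \<subseteq> {1..n}" "length \<rho> + 1 = t"
    by (auto simp: arrangements_def)
  then have w: "word t = word (t - 1) @ form t" using word_Suc[of "t - 1"] by auto
  show ?case
  proof (cases "t < n - s")
    case True
    have "subseq (word (t - 1) @ front t (skips \<rho>)) (word t)"
      unfolding w front_rest[of t "skips \<rho>"]
      using subseq_rev_drop_many[OF subseq_order.order_refl, of "word (t - 1) @ front t (skips \<rho>)"]
      by (metis append.assoc)
    then show ?thesis using embedded_in_front[OF \<rho> True] subseq_order.trans by blast
  next
    case False
    have IH: "subseq \<rho> (word (t - 1))" using snoc \<rho> by (intro snoc.IH) (auto simp: arrangements_def)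
    show ?thesis
    proof (cases "x \<in> set (form t)")
      case True
      then have "subseq [x] (form t)" by (simp add: subseq_singleton_left)
      with IH show ?thesis unfolding w by (rule list_emb_append_mono)
    next
      case x: False
      define i where "i = t - (n - s)"
      have t: "n - s + i = t" "i \<le> s" unfolding i_def using False snoc.prems n_eq by linarith+
      have last: "x = last (form (t - 1))"
        using late_letters[OF t(2), of x] x \<rho>(2) unfolding t by auto
      have "2 < t" using False n_eq s3 by linarith
      then obtain y \<rho>' where y: "\<rho> = \<rho>' @ [y]" using \<rho> by (cases \<rho> rule: rev_cases) auto
      have "word (t - 1) = word (t - 2) @ form (t - 1)"
        using word_Suc[of "t - 2"] \<open>2 < t\<close> by (simp add: numeral_2_eq_2 Suc_diff_Suc)
      also have "form (t - 1) = butlast (form (t - 1)) @ [x]"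
        using form_nonempty[of "t - 1"] \<open>2 < t\<close> snoc.prems last by simp
      finally have w': "word (t - 1) = (word (t - 2) @ butlast (form (t - 1))) @ [x]" by simp
      have "subseq (\<rho>' @ [y, x]) ((word (t - 2) @ butlast (form (t - 1))) @ [x] @ form t)"
        using IH y w' \<rho> by (intro subseq_extend) auto
      then show ?thesis unfolding w w' y by simp
    qed
  qed
qed simp

section \<open>Backward completeness\<close>

text \<open>The renaming that takes the first term to the reverse of the last one: it reverses
  \<open>1, ..., s + 1\<close> and \<open>s + 2, ..., m\<close> separately and fixes the skip
  letters.\<close>

definition flip :: "nat \<Rightarrow> nat" where
  "flip c = (if c \<le> s + 1 then s + 2 - c else if c \<le> m then m + s + 2 - c else c)"

lemma m_gt: "s + 1 < m" using m_eq n_eq by linarith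

lemma flip_in: "c \<in> {1..n} \<Longrightarrow> flip c \<in> {1..n}"
  using m_gt m_eq s3 by (auto simp: flip_def)

lemma flip_flip: "c \<in> {1..n} \<Longrightarrow> flip (flip c) = c"
  using m_gt by (auto simp: flip_def)

lemma map_flip_low: "b \<le> s + 2 \<Longrightarrow> map flip [a..<b] = rev [s + 3 - b..<s + 3 - a]"
  using map_diff_upt[of b "s + 2" a] by (subst map_cong[OF refl, of _ _ "\<lambda>x. s + 2 - x"]) (auto simp: flip_def numeral_3_eq_3)

lemma map_flip_mid:
  assumes "s + 2 \<le> a" "b \<le> m + 1"
  shows "map flip [a..<b] = rev [m + s + 3 - b..<m + s + 3 - a]"
proof -
  have "map flip [a..<b] = map (\<lambda>x. m + s + 2 - x) [a..<b]"
    using assms by (intro map_cong) (auto simp: flip_def)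
  also have "\<dots> = rev [m + s + 2 + 1 - b..<m + s + 2 + 1 - a]"
    using assms by (intro map_diff_upt) simp
  finally show ?thesis by (simp add: numeral_3_eq_3)
qed

lemma map_flip_skip: "m + 1 \<le> a \<Longrightarrow> map flip [a..<b] = [a..<b]"
  using m_gt by (intro map_idI) (auto simp: flip_def)

lemma map_flip_from_1:
  assumes "s + 2 \<le> b" "b \<le> m + 1"
  shows "map flip [1..<b] = rev [1..<s + 2] @ rev [m + s + 3 - b..<m + 1]"
proof -
  have e: "[1..<b] = [1..<s + 2] @ [s + 2..<b]"
    using assms by (intro upt_add_append[symmetric]) auto
  have "map flip [1..<s + 2] = rev [1..<s + 2]"
    using map_flip_low[of "s + 2" 1] by simp
  moreover have "map flip [s + 2..<b] = rev [m + s + 3 - b..<m + 1]"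
    using map_flip_mid[of "s + 2" b] assms by simp
  ultimately show ?thesis unfolding e by (simp del: upt_Suc)
qed

section \<open>Mirror images of the terms\<close>

lemma mirror_early:
  assumes "1 \<le> t" "t \<le> s + 1"
  shows "form (n + 1 - t) = rev (map flip (form t))"
proof -
  have a: "map flip [n + 3 - t..<n + 1] = [n + 3 - t..<n + 1]"
    using assms m_eq by (intro map_flip_skip) linarith
  show ?thesis
  proof (cases "t = s + 1")
    case True
    have e: "n + 3 - t = m + 1" "n + 2 - t = m" "n + 1 - t = n - s" "m + s + 3 - m = s + 3"
      using True m_eq by linarith+
    have b: "map flip [1..<m] = rev [1..<s + 2] @ rev [s + 3..<m + 1]"
      using map_flip_from_1[of m] m_gt unfolding e by simp
    show ?thesis using a b assms unfolding form_early[OF assms(2)] early_def e form_end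
      by (simp del: upt_Suc)
  next
    case False
    define i where "i = s + 1 - t"
    have e: "n + 1 - t = n - s + i" "n + 2 - t = m + i" "n + 3 - t = m + 1 + i" "1 \<le> i"
      unfolding i_def using False assms m_eq m_gt by linarith+
    have "[1..<m + 1] @ [m + 1..<m + i] = [1..<m + i]"
      using e(4) by (intro upt_add_append) linarith+
    moreover have "map flip [m + 1..<m + i] = [m + 1..<m + i]" by (rule map_flip_skip) simp
    moreover have "map flip [1..<m + 1] = rev [1..<s + 2] @ rev [s + 2..<m + 1]"
      using map_flip_from_1[of "m + 1"] m_gt by simp
    ultimately have b: "map flip [1..<m + i] = rev [1..<s + 2] @ rev [s + 2..<m + 1] @ [m + 1..<m + i]"
      by (metis append.assoc map_append)
    show ?thesis using a b unfolding form_early[OF assms(2)] early_def e form_late[OF e(4)] late_def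
      by (simp del: upt_Suc)
  qed
qed

lemma mirror_bare:
  assumes "u \<le> M" "t = s + 2 + u * q + (s - 1)"
  shows "form (n + 1 - t) = rev (map flip (form t))"
proof -
  have Mq: "M * q = u * q + (M - u) * q" using assms(1) by (simp add: add_mult_distrib[symmetric])
  have t: "s + 2 \<le> n + 2 - t" "n + 2 - t \<le> m + 1" "s + 2 \<le> t" "t \<le> n"
    using assms(2) Mq n_eq m_eq s3 q_eq by linarith+
  have "n + 1 - t = s + 2 + (M - u) * q + (s - 1)"
    using assms(2) n_eq Mq s3 by linarith
  then have f: "form (n + 1 - t) = bare (n + 1 - t)" using form_bare[of "M - u"] by simp
  have e: "n + 3 - (n + 1 - t) = t + 2" "n + 2 - (n + 1 - t) = t + 1"
    "m + s + 3 - (n + 2 - t) = t + 2" "m + s + 3 - (n + 3 - t) = t + 1" "m + s + 3 - (m + 1) = s + 2"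
    using t m_eq by linarith+
  have a: "map flip [n + 3 - t..<m + 1] = rev [s + 2..<t + 1]"
    using map_flip_mid[of "n + 3 - t" "m + 1"] t unfolding e by simp
  have b: "map flip [1..<n + 2 - t] = rev [1..<s + 2] @ rev [t + 2..<m + 1]"
    using map_flip_from_1[of "n + 2 - t"] t unfolding e by simp
  have "[1..<s + 2] @ [s + 2..<t + 1] = [1..<t + 1]"
    using t by (intro upt_add_append) linarith+
  then show ?thesis using a b unfolding f form_bare[OF assms] bare_def e by (simp del: upt_Suc)
qed

text \<open>Mirroring exchanges \<open>up\<close> and \<open>down\<close>, period \<open>u\<close>
  and \<open>M - u\<close>, place \<open>v\<close> and \<open>s - 2 - v\<close> of a run. The letter
  \<open>c + 1\<close> behind the block becomes the letter in front of it, which explains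
  \<open>d\<close> as the image of \<open>c + 1\<close> under \<open>flip\<close>.\<close>

lemma mirror_up:
  assumes "u \<le> M" "v + 2 \<le> s" "t = s + 2 + u * q + v"
  shows "form (n + 1 - t) = rev (map flip (form t))"
proof -
  have Mq: "M * q = u * q + (M - u) * q" using assms(1) by (simp add: add_mult_distrib[symmetric])
  define c where "c = m - (s + 1 + u * q)"
  define d where "d = n + 1 - (2 * s + (M - u) * q)"
  have t: "s + 2 \<le> c + 1" "c \<le> m" "s + 2 \<le> n + 2 - t" "n + 2 - t \<le> m + 1" "s + 2 \<le> t" "t \<le> n" "c + 1 \<le> n + 2 - t"
    unfolding c_def using assms(2,3) Mq n_eq m_eq s3 q_eq by linarith+
  have d: "m + s + 3 - (c + 1) = d + 1" "t + 2 \<le> d + 1" "d \<le> m"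
    unfolding c_def d_def using assms(2,3) Mq n_eq m_eq s3 q_eq by linarith+
  have "n + 1 - t = 2 * s + 2 + (M - u) * q + (s - 2 - v)" "s - 2 - v + 2 \<le> s"
    using assms(2,3) n_eq Mq s3 by linarith+
  then have f: "form (n + 1 - t) = down d (n + 1 - t)" unfolding d_def using form_down[of "M - u"] by simp
  have e: "n + 3 - (n + 1 - t) = t + 2" "n + 2 - (n + 1 - t) = t + 1"
    "m + s + 3 - (n + 2 - t) = t + 2" "m + s + 3 - (n + 3 - t) = t + 1" "m + s + 3 - (m + 1) = s + 2"
    using t m_eq by linarith+
  have a: "map flip [n + 3 - t..<m + 1] = rev [s + 2..<t + 1]"
    using map_flip_mid[of "n + 3 - t" "m + 1"] t unfolding e by simp
  have b: "map flip [1..<c + 1] = rev [1..<s + 2] @ rev [d + 1..<m + 1]"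
    using map_flip_from_1[of "c + 1"] t unfolding d by simp
  have b': "map flip [c + 1..<n + 2 - t] = rev [t + 2..<d + 1]"
    using map_flip_mid[of "c + 1" "n + 2 - t"] t unfolding d e by simp
  have U: "map flip [m + 1..<n + 1] = [m + 1..<n + 1]" by (rule map_flip_skip) simp
  have "[1..<s + 2] @ [s + 2..<t + 1] = [1..<t + 1]"
    using t by (intro upt_add_append) linarith+
  then show ?thesis using a b b' U unfolding f form_up[OF assms, folded c_def] up_def down_def e
    by (simp del: upt_Suc)
qed

lemma set_form:
  assumes "1 \<le> t" "t \<le> n"
  shows "set (form t) \<subseteq> {1..n}"
proof -
  have mn: "m \<le> n" using m_eq s3 by linarith
  consider "t \<le> s + 1" | "s + 1 < t" "t < n - s" | "t = n - s" | "n - s < t" by linarith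
  then show ?thesis
  proof cases
    case 1
    then show ?thesis using assms by (auto simp: form_early early_def simp del: upt_Suc)
  next
    case 2
    then show ?thesis
    proof (cases rule: mid_cases)
      case (up u v)
      then show ?thesis using form_up[OF up] mn 2 by (auto simp: up_def simp del: upt_Suc)
    next
      case (bare u)
      then show ?thesis using form_bare[OF bare] mn 2 by (auto simp: bare_def simp del: upt_Suc)
    next
      case (down u v)
      define c where "c = n + 1 - (2 * s + u * q)"
      have "c \<le> n" using s3 by (simp add: c_def)
      then show ?thesis using form_down[OF down, folded c_def] mn 2 by (auto simp: down_def simp del: upt_Suc)
    qed
  next
    case 3
    then show ?thesis using form_end mn m_gt by (auto simp del: upt_Suc)
  next
    case 4
    define i where "i = t - (n - s)"
    have i: "t = n - s + i" "1 \<le> i" "m + i \<le> n + 1" using 4 assms m_eq m_gt by (auto simp: i_def)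
    then show ?thesis using form_late[OF i(2)] mn m_gt by (auto simp: late_def simp del: upt_Suc)
  qed
qed

lemma mirror_mirror: "set xs \<subseteq> {1..n} \<Longrightarrow> rev (map flip (rev (map flip xs))) = xs"
  unfolding rev_map rev_rev_ident map_map by (rule map_idI) (use flip_flip in auto)

lemma mirror_form:
  assumes "1 \<le> t" "t \<le> n"
  shows "form (n + 1 - t) = rev (map flip (form t))"
proof -
  \<comment> \<open>Mirroring twice gives the term back, so the \<open>down\<close> terms and the
    final terms follow from the \<open>up\<close> terms and the early ones.\<close>
  have via_mirror: ?thesis if "form (n + 1 - t') = rev (map flip (form t'))" "n + 1 - t = t'" "1 \<le> t'" for t'
  proof -
    have "n + 1 - t' = t" "t' \<le> n" using that assms by linarith+
    then show ?thesis using that mirror_mirror[OF set_form, of t'] by metis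
  qed
  consider "t \<le> s + 1" | "s + 1 < t" "t < n - s" | "n - s \<le> t" by linarith
  then show ?thesis
  proof cases
    case 1
    then show ?thesis using mirror_early assms by simp
  next
    case 2
    then show ?thesis
    proof (cases rule: mid_cases)
      case (up u v)
      then show ?thesis by (rule mirror_up)
    next
      case (bare u)
      then show ?thesis by (rule mirror_bare)
    next
      case (down u v)
      have "M * q = u * q + (M - u) * q" using down(1) by (simp add: add_mult_distrib[symmetric])
      then have t': "s - 2 - v + 2 \<le> s" "n + 1 - t = s + 2 + (M - u) * q + (s - 2 - v)"
        using down n_eq s3 by linarith+
      show ?thesis using mirror_up[OF _ t'] by (intro via_mirror[of "n + 1 - t"]) (use 2 in auto)
    qed
  next
    case 3
    have "1 \<le> n + 1 - t" "n + 1 - t \<le> s + 1" using 3 assms by linarith+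
    then show ?thesis by (intro via_mirror[of "n + 1 - t"] mirror_early refl) simp_all
  qed
qed

section \<open>Transfer to the reversed list and strong completeness\<close>

lemma mirror_word: "k \<le> n \<Longrightarrow> concat (map form [n - k + 1..<n + 1]) = rev (map flip (word k))"
proof (induction k)
  case 0
  then show ?case by (simp add: word_def)
next
  case (Suc k)
  have "[n - Suc k + 1..<n + 1] = (n - k) # [n - k + 1..<n + 1]"
    using Suc.prems by (simp add: upt_conv_Cons Suc_diff_Suc del: upt_Suc)
  then show ?case using Suc mirror_form[of "Suc k"] by (simp add: word_Suc del: upt_Suc)
qed

lemma mirror_arrangement:
  assumes "\<rho> \<in> arrangements {1..n} k"
  shows "rev (map flip \<rho>) \<in> arrangements {1..n} k"
proof -
  have "inj_on flip {1..n}" by (metis flip_flip inj_onI)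
  then have "inj_on flip (set \<rho>)" using assms by (auto simp: arrangements_def intro: inj_on_subset)
  moreover have "flip ` set \<rho> \<subseteq> {1..n}" using assms flip_in by (fastforce simp: arrangements_def)
  ultimately show ?thesis using assms by (simp add: arrangements_def distinct_map)
qed

lemma T_list_form: "T_list s n = map form [1..<n + 1]"
  unfolding T_list_def by (intro map_cong) (auto simp: T_seq_form simp del: upt_Suc)

lemma strongly_complete_T_list: "strongly_complete {1..n} (T_list s n)"
proof -
  have over: "list_over {1..n} (T_list s n)"
    using set_form unfolding list_over_def T_list_form by (auto simp del: upt_Suc)
  have word: "set (word k) \<subseteq> {1..n}" if "k \<le> n" for k
    using set_form that by (fastforce simp: word_def simp del: upt_Suc)
  have fwd: "concat (take k (T_list s n)) = word k" if "k \<le> n" for k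
    using that by (simp add: T_list_form take_map take_upt word_def del: upt_Suc)
  have bwd: "concat (drop (n - k) (T_list s n)) = rev (map flip (word k))" if "k \<le> n" for k
    using mirror_word[OF that] by (simp add: T_list_form drop_map add.commute del: upt_Suc)
  have "k_complete {1..n} k (word k)" if "k \<le> n" for k
    using that word arrangement_subseq_word by (auto simp: k_complete_def)
  moreover have "k_complete {1..n} k (rev (map flip (word k)))" if "k \<le> n" for k
  proof -
    have "subseq \<rho> (rev (map flip (word k)))" if \<rho>: "\<rho> \<in> arrangements {1..n} k" for \<rho>
    proof -
      \<comment> \<open>The mirrored arrangement is embedded in the first \<open>k\<close> terms;
        mirroring both sides gives \<open>\<rho>\<close> inside the last \<open>k\<close>
        terms.\<close>
      have "subseq (rev (map flip \<rho>)) (word k)"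
        using mirror_arrangement[OF \<rho>] \<open>k \<le> n\<close> by (rule arrangement_subseq_word)
      then have "subseq (rev (map flip (rev (map flip \<rho>)))) (rev (map flip (word k)))"
        by (intro subseq_rev subseq_map)
      then show ?thesis using mirror_mirror[of \<rho>] \<rho> by (simp add: arrangements_def)
    qed
    moreover have "set (rev (map flip (word k))) \<subseteq> {1..n}" using word[OF that] flip_in by fastforce
    ultimately show ?thesis using that by (simp add: k_complete_def)
  qed
  moreover have "length (T_list s n) = n" by (simp add: T_list_form del: upt_Suc)
  ultimately show ?thesis
    using over fwd bwd by (simp add: strongly_complete_def forward_complete_def backward_complete_def)
qed

end

theorem theorem21:
  fixes s n :: nat
  assumes "s \<ge> 3" and "n \<ge> 4 * s + 1" and "[n = 3] (mod (2 * s - 1))"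
  shows "strongly_complete {1..n} (T_list s n)"
proof -
  define q where "q = 2 * s - 1"
  have "q dvd n - 3" using assms by (simp add: q_def cong_altdef_nat)
  then obtain j where j: "n - 3 = q * j" by blast
  \<comment> \<open>Since \<open>4 * s + 1 = 2 * q + 3\<close>, the lower bound on \<open>n\<close>
    yields \<open>j >= 2\<close>, and \<open>M\<close> is what remains.\<close>
  have "n = 3 + q * j" "q > 0" "2 * q + 3 \<le> n" using assms j by (auto simp: q_def)
  then have n: "n = 3 + q * j" "q * j \<ge> q * 2" "q > 0" by linarith+
  then obtain M where "j = M + 2" by (metis add.commute le_Suc_ex mult_le_cancel1)
  then have "n = 4 * s + 1 + M * q" using n assms(1) by (simp add: q_def algebra_simps)
  then interpret skip_list s n "n + 1 - s" q M
    using assms by unfold_locales (auto simp: q_def)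
  show ?thesis by (rule strongly_complete_T_list)
qed

end
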